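(* Assume the heat hypothesis, fix $\eta\in(0,1)$, and let $\nu$ be a Lévy measure on the space $L_2(H,H)$ of Hilbert–Schmidt operators whose support is contained in the set of operators diagonal with respect to $(e_j)$ with real diagonal entries. Let $\widetilde N$ be the compensated Poisson random measure with intensity $\nu(\mathrm{d}z)\mathrm{d}t$. For $\varepsilon\in(0,1)$ and $h\in D(A)$ let $\mathcal{X}^{(\eta,\varepsilon)}_t(h)$ be the mild solution of $\mathrm{d}\mathcal{X}_t=A\mathcal{X}_t\,\mathrm{d}t+\varepsilon\int_{\eta\leqslant\|z\|<1}z\mathcal{X}_{t-}\,\widetilde N(\mathrm{d}z,\mathrm{d}t)$, $\mathcal{X}_0=h$ (here $\|\cdot\|$ is the Hilbert–Schmidt norm). Let $h\neq0$, let $(a_\varepsilon)$ be positive with $\lim_{\varepsilon\to0}a_\varepsilon=0$ and $\lim_{\varepsilon\to0}\varepsilon|\ln a_\varepsilon|=0$, and $t_\varepsilon=\frac1{\lambda_{N_h}}|\ln a_\varepsilon|$. Then for every $\varrho\in\mathbb{R}$, \[ \lim_{\varepsilon\to0}\frac{\mathcal{W}_2(\mathcal{X}^{(\eta,\varepsilon)}_{t_\varepsilon+\varrho}(h),\delta_0)}{a_\varepsilon}=e^{-\lambda_{N_h}\varrho}|v_h|. \]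
   Context: $H$ is a real separable infinite-dimensional Hilbert space with inner product $\langle\cdot,\cdot\rangle$, norm $|\cdot|$. Heat hypothesis: $A$ is self-adjoint, strictly negative with domain $D(A)\subset H$, with an orthonormal basis $(e_n)_{n\in\mathbb{N}_0}\subset D(A)$, $Ae_n=-\lambda_ne_n$, $0<\lambda_0\leqslant\lambda_1\leqslant\cdots$, $\lambda_n\to\infty$; $S(t)=e^{tA}$. For $h\neq0$: $\mathcal{K}_h=\{k:\langle e_k,h\rangle\neq0\}$, $N_h=\min\mathcal{K}_h$, $\mathcal{M}_h=\{k\in\mathcal{K}_h:\lambda_k=\lambda_{N_h}\}$, $v_h=\sum_{k\in\mathcal{M}_h}\langle e_k,h\rangle e_k$. Mild solution means $\mathcal{X}_t=S(t)h+\varepsilon\int_0^t\int_{\eta\leqslant\|z\|<1}S(t-s)\,z\,\mathcal{X}_{s-}\,\widetilde N(\mathrm{d}z,\mathrm{d}s)$ a.s. for all $t\geqslant0$. $\delta_0$ is the invariant measure and $\mathcal{W}_2(\mathcal{X},\delta_0)=(\mathbb{E}|\mathcal{X}|^2)^{1/2}$. *)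

theory Defs
  imports "HOL-Probability.Probability"
begin

definition orthonormal_basis :: "(nat \<Rightarrow> 'h::{real_inner,complete_space,second_countable_topology}) \<Rightarrow> bool" where
  "orthonormal_basis e \<longleftrightarrow>
     (\<forall>m n. e m \<bullet> e n = (if m = n then 1 else 0)) \<and> closure (span (range e)) = UNIV"

definition heat_hyp ::
  "(nat \<Rightarrow> 'h::{real_inner,complete_space,second_countable_topology}) \<Rightarrow> (nat \<Rightarrow> real) \<Rightarrow> 'h set \<Rightarrow> ('h \<Rightarrow> 'h) \<Rightarrow> bool" where
  "heat_hyp e lam DA A \<longleftrightarrow>
     orthonormal_basis e \<and>
     subspace DA \<and>
     (\<forall>x\<in>DA. \<forall>y\<in>DA. A (x + y) = A x + A y) \<and>
     (\<forall>x\<in>DA. \<forall>c. A (c *\<^sub>R x) = c *\<^sub>R A x) \<and>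
     closure DA = UNIV \<and>
     (\<forall>x\<in>DA. \<forall>y\<in>DA. A x \<bullet> y = x \<bullet> A y) \<and>
     {y. \<exists>w. \<forall>x\<in>DA. A x \<bullet> y = x \<bullet> w} = DA \<and>
     (\<forall>x\<in>DA. x \<noteq> 0 \<longrightarrow> A x \<bullet> x < 0) \<and>
     (\<forall>n. e n \<in> DA \<and> A (e n) = - (lam n *\<^sub>R e n)) \<and>
     0 < lam 0 \<and> mono lam \<and> filterlim lam at_top sequentially"

definition heat_sg :: "(nat \<Rightarrow> 'h::{real_inner,complete_space,second_countable_topology}) \<Rightarrow> (nat \<Rightarrow> real) \<Rightarrow> real \<Rightarrow> 'h \<Rightarrow> 'h" where
  "heat_sg e lam t x = (\<Sum>n. (exp (- t * lam n) * (e n \<bullet> x)) *\<^sub>R e n)"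

definition N_idx :: "(nat \<Rightarrow> 'h::real_inner) \<Rightarrow> 'h \<Rightarrow> nat" where
  "N_idx e h = (LEAST k. e k \<bullet> h \<noteq> 0)"

definition M_set :: "(nat \<Rightarrow> 'h::real_inner) \<Rightarrow> (nat \<Rightarrow> real) \<Rightarrow> 'h \<Rightarrow> nat set" where
  "M_set e lam h = {k. e k \<bullet> h \<noteq> 0 \<and> lam k = lam (N_idx e h)}"

definition v_vec :: "(nat \<Rightarrow> 'h::real_inner) \<Rightarrow> (nat \<Rightarrow> real) \<Rightarrow> 'h \<Rightarrow> 'h" where
  "v_vec e lam h = (\<Sum>k\<in>M_set e lam h. (e k \<bullet> h) *\<^sub>R e k)"

definition hs_norm :: "(nat \<Rightarrow> 'h::real_normed_vector) \<Rightarrow> ('h \<Rightarrow>\<^sub>L 'h) \<Rightarrow> real" where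
  "hs_norm e z = sqrt (\<Sum>n. (norm (blinfun_apply z (e n)))\<^sup>2)"

definition diag_HS :: "(nat \<Rightarrow> 'h::real_normed_vector) \<Rightarrow> ('h \<Rightarrow>\<^sub>L 'h) set" where
  "diag_HS e = {z. summable (\<lambda>n. (norm (blinfun_apply z (e n)))\<^sup>2) \<and>
                   (\<forall>j. \<exists>d::real. blinfun_apply z (e j) = d *\<^sub>R e j)}"

definition levy_measure :: "(nat \<Rightarrow> 'h::real_normed_vector) \<Rightarrow> ('h \<Rightarrow>\<^sub>L 'h) measure \<Rightarrow> bool" where
  "levy_measure e \<nu> \<longleftrightarrow>
     sets \<nu> = sets borel \<and> emeasure \<nu> {0} = 0 \<and>
     (\<integral>\<^sup>+ z. ennreal (min 1 ((hs_norm e z)\<^sup>2)) \<partial>\<nu>) < \<infinity>"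

definition intensity :: "('h::real_normed_vector \<Rightarrow>\<^sub>L 'h) measure \<Rightarrow> (real \<times> ('h \<Rightarrow>\<^sub>L 'h)) measure" where
  "intensity \<nu> = density lborel (indicator {0..}) \<Otimes>\<^sub>M \<nu>"

definition poisson_random_measure ::
  "'w measure \<Rightarrow> 'a measure \<Rightarrow> ('w \<Rightarrow> 'a measure) \<Rightarrow> bool" where
  "poisson_random_measure M \<mu> N \<longleftrightarrow>
     (\<forall>\<omega>\<in>space M. sets (N \<omega>) = sets \<mu> \<and>
        (\<forall>B\<in>sets \<mu>. emeasure (N \<omega>) B \<in> range of_nat \<union> {\<infinity>})) \<and>
     (\<forall>B\<in>sets \<mu>. (\<lambda>\<omega>. emeasure (N \<omega>) B) \<in> borel_measurable M) \<and>
     (\<forall>B\<in>sets \<mu>. emeasure \<mu> B < \<infinity> \<longrightarrow>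
        (\<forall>n::nat. measure M {\<omega>\<in>space M. emeasure (N \<omega>) B = of_nat n}
                   = measure \<mu> B ^ n / fact n * exp (- measure \<mu> B))) \<and>
     (\<forall>(I::nat set) B. finite I \<longrightarrow> (\<forall>i\<in>I. B i \<in> sets \<mu>) \<longrightarrow> disjoint_family_on B I \<longrightarrow>
        prob_space.indep_vars M (\<lambda>_. borel) (\<lambda>i \<omega>. emeasure (N \<omega>) (B i)) I)"

definition jump_set :: "(nat \<Rightarrow> 'h::real_normed_vector) \<Rightarrow> real \<Rightarrow> ('h \<Rightarrow>\<^sub>L 'h) set" where
  "jump_set e \<eta> = {z. \<eta> \<le> hs_norm e z \<and> hs_norm e z < 1}"

definition mild_integrand ::
  "(nat \<Rightarrow> 'h::{real_inner,complete_space,second_countable_topology}) \<Rightarrow> (nat \<Rightarrow> real) \<Rightarrow> real \<Rightarrow> (real \<Rightarrow> 'h) \<Rightarrow> real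
     \<Rightarrow> real \<times> ('h \<Rightarrow>\<^sub>L 'h) \<Rightarrow> 'h" where
  "mild_integrand e lam \<eta> x t = (\<lambda>(s, z).
     indicator ({0..t} \<times> jump_set e \<eta>) (s, z) *\<^sub>R
       heat_sg e lam (t - s) (blinfun_apply z (Lim (at_left s) x)))"

text \<open>Since nu{eta <= ||z|| < 1} is finite, the compensated integral is the (a.s. finite)
  sum over the atoms of N minus the compensator integral.\<close>
definition mild_solution ::
  "'w measure \<Rightarrow> ('w \<Rightarrow> (real \<times> ('h \<Rightarrow>\<^sub>L 'h)) measure) \<Rightarrow> (nat \<Rightarrow> 'h::{real_inner,complete_space,second_countable_topology})
     \<Rightarrow> (nat \<Rightarrow> real) \<Rightarrow> ('h \<Rightarrow>\<^sub>L 'h) measure \<Rightarrow> real \<Rightarrow> real \<Rightarrow> 'h \<Rightarrow> (real \<Rightarrow> 'w \<Rightarrow> 'h) \<Rightarrow> bool" where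
  "mild_solution M N e lam \<nu> \<eta> \<epsilon> h X \<longleftrightarrow>
     (\<forall>t. X t \<in> borel_measurable M) \<and>
     (AE \<omega> in M. \<forall>t\<ge>0.
        integrable (N \<omega>) (mild_integrand e lam \<eta> (\<lambda>r. X r \<omega>) t) \<and>
        integrable (intensity \<nu>) (mild_integrand e lam \<eta> (\<lambda>r. X r \<omega>) t) \<and>
        X t \<omega> = heat_sg e lam t h + \<epsilon> *\<^sub>R
           ((\<integral>p. mild_integrand e lam \<eta> (\<lambda>r. X r \<omega>) t p \<partial>(N \<omega>))
            - (\<integral>p. mild_integrand e lam \<eta> (\<lambda>r. X r \<omega>) t p \<partial>(intensity \<nu>))))"

definition W2_delta0 :: "'w measure \<Rightarrow> ('w \<Rightarrow> 'h::real_normed_vector) \<Rightarrow> real" where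
  "W2_delta0 M Y = sqrt (enn2real (\<integral>\<^sup>+ \<omega>. ennreal ((norm (Y \<omega>))\<^sup>2) \<partial>M))"

end

theory Submission
  imports Defs
begin

text \<open>In coordinates, diagonality decouples the equation: \<open>y\<^sub>j(t) = exp (\<lambda>\<^sub>j t) \<langle>e\<^sub>j, X\<^sub>t\<rangle>\<close> solves a scalar
  equation driven by \<open>N - \<nu> dt\<close> on \<open>\<eta> \<le> \<parallel>z\<parallel> < 1\<close>, where all diagonal entries have modulus at most 1.
  With \<open>F(t) = \<epsilon> (N([0,t] \<times> J) + t \<nu>(J))\<close> and \<open>J = {\<eta> \<le> \<parallel>z\<parallel> < 1}\<close>, a pathwise Gronwall argument gives
  \<open>\<bar>y\<^sub>j(t) - y\<^sub>j(0)\<bar> \<le> \<bar>y\<^sub>j(0)\<bar> (exp (2 F(t)) - 1)\<close> for all \<open>j\<close> at once, hence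
  \<open>\<bar>X\<^sub>t - S(t)h\<bar> \<le> (exp (2 F(t)) - 1) \<bar>S(t)h\<bar>\<close>. As \<open>N([0,t] \<times> J)\<close> is Poisson with mean \<open>t \<nu>(J)\<close>,
  \<open>E exp (4 F(t))\<close> tends to 1 when \<open>\<epsilon> t\<close> tends to 0, so the second moment of \<open>X\<^sub>t\<close> is asymptotic to
  \<open>\<bar>S(t)h\<bar>\<^sup>2\<close>, whose decay is read off from its spectral expansion.\<close>

section \<open>Expansions in the orthonormal basis\<close>

lemma orthonormal_basis_inner:
  "orthonormal_basis e \<Longrightarrow> e m \<bullet> e n = (if m = n then 1 else 0)"
  by (simp add: orthonormal_basis_def)

lemma norm_sum_orthonormal:
  fixes e :: "nat \<Rightarrow> 'h::{real_inner,complete_space,second_countable_topology}"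
  assumes "orthonormal_basis e" "finite I"
  shows "(norm (\<Sum>k\<in>I. c k *\<^sub>R e k))\<^sup>2 = (\<Sum>k\<in>I. (c k)\<^sup>2)"
proof -
  have "(norm (\<Sum>k\<in>I. c k *\<^sub>R e k))\<^sup>2 = (\<Sum>k\<in>I. \<Sum>j\<in>I. c k * c j * (e k \<bullet> e j))"
    by (simp add: power2_norm_eq_inner inner_sum_left inner_sum_right mult.assoc sum_distrib_left
        inner_commute mult.left_commute)
  also have "\<dots> = (\<Sum>k\<in>I. \<Sum>j\<in>I. if k = j then c k * c j else 0)"
    by (intro sum.cong refl) (simp add: orthonormal_basis_inner[OF assms(1)])
  also have "\<dots> = (\<Sum>k\<in>I. (c k)\<^sup>2)"
    using assms(2) by (simp add: power2_eq_square)
  finally show ?thesis .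
qed

text \<open>The agreement set of two continuous linear functionals is a closed subspace; containing
  every \<open>e k\<close>, it contains the closure of their span, which is everything. This
  identifies vectors as well as the action of diagonal operators.\<close>

lemma basis_functional_eqI:
  fixes e :: "nat \<Rightarrow> 'h::{real_inner,complete_space,second_countable_topology}"
    and f g :: "'h \<Rightarrow> real"
  assumes e: "orthonormal_basis e" and f: "bounded_linear f" and g: "bounded_linear g"
    and eq: "\<And>k. f (e k) = g (e k)"
  shows "f x = g x"
proof -
  interpret f: bounded_linear f by fact
  interpret g: bounded_linear g by fact
  have sub: "subspace {x. f x = g x}"
    by (auto simp: subspace_def f.zero g.zero f.add g.add f.scaleR g.scaleR)
  have cl: "closed {x. f x = g x}"
    by (intro closed_Collect_eq) (auto intro: linear_continuous_on f g)
  have "span (range e) \<subseteq> {x. f x = g x}"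
    using sub eq by (intro span_minimal) auto
  then have "closure (span (range e)) \<subseteq> {x. f x = g x}"
    using cl by (rule closure_minimal)
  then show ?thesis using e by (auto simp: orthonormal_basis_def)
qed

lemma basis_eqI:
  fixes e :: "nat \<Rightarrow> 'h::{real_inner,complete_space,second_countable_topology}"
  assumes e: "orthonormal_basis e" and eq: "\<And>k. e k \<bullet> x = e k \<bullet> y"
  shows "x = y"
proof -
  have "z \<bullet> x = z \<bullet> y" for z
    by (rule basis_functional_eqI[OF e]) (auto intro: bounded_linear_inner_left eq)
  then show ?thesis
    by (metis inner_commute vector_eq_rdot)
qed

lemma bessel_partial:
  fixes e :: "nat \<Rightarrow> 'h::{real_inner,complete_space,second_countable_topology}"
  assumes e: "orthonormal_basis e"
  shows "(\<Sum>k<n. (e k \<bullet> x)\<^sup>2) \<le> (norm x)\<^sup>2"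
proof -
  let ?p = "\<Sum>k<n. (e k \<bullet> x) *\<^sub>R e k"
  have px: "?p \<bullet> x = (\<Sum>k<n. (e k \<bullet> x)\<^sup>2)"
    by (simp add: inner_sum_left power2_eq_square)
  have pp: "?p \<bullet> ?p = (\<Sum>k<n. (e k \<bullet> x)\<^sup>2)"
    using norm_sum_orthonormal[OF e, of "{..<n}" "\<lambda>k. e k \<bullet> x"]
    by (simp add: power2_norm_eq_inner)
  have "0 \<le> (x - ?p) \<bullet> (x - ?p)" by simp
  also have "\<dots> = x \<bullet> x - (\<Sum>k<n. (e k \<bullet> x)\<^sup>2)"
    using px pp by (simp add: inner_diff_left inner_diff_right inner_commute)
  finally show ?thesis by (simp add: power2_norm_eq_inner)
qed

lemma summable_coord_sq:
  fixes e :: "nat \<Rightarrow> 'h::{real_inner,complete_space,second_countable_topology}"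
  assumes "orthonormal_basis e"
  shows "summable (\<lambda>k. (e k \<bullet> x)\<^sup>2)"
  by (rule summableI_nonneg_bounded[where x="(norm x)\<^sup>2"]) (auto intro: bessel_partial assms)

text \<open>By Pythagoras the squared norm of a block of the series is the matching block of the
  series of squares, so the Cauchy property transfers, and \<open>'h\<close> is complete.\<close>

lemma summable_orthonormal:
  fixes e :: "nat \<Rightarrow> 'h::{real_inner,complete_space,second_countable_topology}"
  assumes e: "orthonormal_basis e" and c: "summable (\<lambda>k. (c k)\<^sup>2)"
  shows "summable (\<lambda>k. c k *\<^sub>R e k)"
  unfolding summable_iff_convergent
proof (intro Cauchy_convergent CauchyI)
  fix r :: real assume "0 < r"
  then have "0 < r\<^sup>2" by simp
  then obtain K where K: "\<And>m n. m \<ge> K \<Longrightarrow> norm (\<Sum>k=m..<n. (c k)\<^sup>2) < r\<^sup>2"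
    using c unfolding summable_Cauchy by blast
  have *: "norm ((\<Sum>k<n. c k *\<^sub>R e k) - (\<Sum>k<m. c k *\<^sub>R e k)) < r" if "K \<le> m" "m \<le> n" for m n
  proof -
    have "(\<Sum>k<n. c k *\<^sub>R e k) - (\<Sum>k<m. c k *\<^sub>R e k) = (\<Sum>k=m..<n. c k *\<^sub>R e k)"
      using that sum_diff_nat_ivl[of 0 m n "\<lambda>k. c k *\<^sub>R e k"] by (simp add: lessThan_atLeast0)
    then have "(norm ((\<Sum>k<n. c k *\<^sub>R e k) - (\<Sum>k<m. c k *\<^sub>R e k)))\<^sup>2 = (\<Sum>k=m..<n. (c k)\<^sup>2)"
      by (simp add: norm_sum_orthonormal[OF e])
    also have "\<dots> < r\<^sup>2" using K[OF \<open>K \<le> m\<close>, of n] by (simp add: sum_nonneg)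
    finally show ?thesis using \<open>0 < r\<close> by (simp add: power2_less_imp_less)
  qed
  show "\<exists>M. \<forall>m\<ge>M. \<forall>n\<ge>M. norm ((\<Sum>k<m. c k *\<^sub>R e k) - (\<Sum>k<n. c k *\<^sub>R e k)) < r"
  proof (intro exI allI impI)
    fix m n assume "K \<le> m" "K \<le> n"
    then show "norm ((\<Sum>k<m. c k *\<^sub>R e k) - (\<Sum>k<n. c k *\<^sub>R e k)) < r"
      using *[of m n] *[of n m] by (cases "m \<le> n") (auto simp: norm_minus_commute)
  qed
qed

lemma inner_suminf_orthonormal:
  fixes e :: "nat \<Rightarrow> 'h::{real_inner,complete_space,second_countable_topology}"
  assumes e: "orthonormal_basis e" and c: "summable (\<lambda>k. (c k)\<^sup>2)"
  shows "e j \<bullet> (\<Sum>k. c k *\<^sub>R e k) = c j"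
proof -
  have "e j \<bullet> (\<Sum>k. c k *\<^sub>R e k) = (\<Sum>k. e j \<bullet> (c k *\<^sub>R e k))"
    by (rule bounded_linear.suminf[OF bounded_linear_inner_right summable_orthonormal[OF e c]])
  also have "\<dots> = (\<Sum>k. if k = j then c j else 0)"
    by (intro arg_cong[where f=suminf] ext) (simp add: orthonormal_basis_inner[OF e])
  also have "\<dots> = c j" using suminf_finite[of "{j}" "\<lambda>k. if k = j then c j else 0"] by simp
  finally show ?thesis .
qed

text \<open>The expansion of \<open>x\<close> converges to a vector with the coordinates of
  \<open>x\<close>, hence to \<open>x\<close>; continuity of the norm then carries the finite
  Pythagoras identity to the limit.\<close>

lemma parseval:
  fixes e :: "nat \<Rightarrow> 'h::{real_inner,complete_space,second_countable_topology}"
  assumes e: "orthonormal_basis e"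
  shows "(\<Sum>k. (e k \<bullet> x)\<^sup>2) = (norm x)\<^sup>2"
proof -
  note s = summable_coord_sq[OF e, of x]
  have x: "(\<Sum>k. (e k \<bullet> x) *\<^sub>R e k) = x"
    by (rule basis_eqI[OF e]) (rule inner_suminf_orthonormal[OF e s])
  have "(\<lambda>n. \<Sum>k<n. (e k \<bullet> x) *\<^sub>R e k) \<longlonglongrightarrow> x"
    using summable_LIMSEQ[OF summable_orthonormal[OF e s]] by (simp add: x)
  then have "(\<lambda>n. (norm (\<Sum>k<n. (e k \<bullet> x) *\<^sub>R e k))\<^sup>2) \<longlonglongrightarrow> (norm x)\<^sup>2"
    by (intro tendsto_intros)
  then have "(\<lambda>n. \<Sum>k<n. (e k \<bullet> x)\<^sup>2) \<longlonglongrightarrow> (norm x)\<^sup>2"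
    by (simp add: norm_sum_orthonormal[OF e])
  then show ?thesis
    using summable_LIMSEQ[OF s] LIMSEQ_unique by blast
qed

text \<open>\<open>heat_sg\<close> is a bare series, so its coordinates can be read off only after
  convergence is known. The sign conditions keep the damping factors at most 1, and the coordinates
  of \<open>x\<close> serve as majorant.\<close>

lemma inner_heat_sg:
  fixes e :: "nat \<Rightarrow> 'h::{real_inner,complete_space,second_countable_topology}"
  assumes e: "orthonormal_basis e" and lam: "\<And>n. 0 \<le> lam n" and t: "0 \<le> t"
  shows "e j \<bullet> heat_sg e lam t x = exp (- t * lam j) * (e j \<bullet> x)"
  unfolding heat_sg_def
proof (rule inner_suminf_orthonormal[OF e], rule summable_comparison_test'[OF summable_coord_sq[OF e, of x]])
  fix n
  have "exp (- t * lam n) \<le> 1" using lam[of n] t by simp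
  then have "(exp (- t * lam n) * (e n \<bullet> x))\<^sup>2 \<le> 1 * (e n \<bullet> x)\<^sup>2"
    unfolding power_mult_distrib by (intro mult_right_mono) (auto simp: power_le_one)
  then show "norm ((exp (- t * lam n) * (e n \<bullet> x))\<^sup>2) \<le> (e n \<bullet> x)\<^sup>2" by simp
qed

text \<open>Parseval on both sides. The constant must not depend on \<open>j\<close>, which is why
  the coordinate estimates below aim at one common factor.\<close>

lemma norm_le_coord:
  fixes e :: "nat \<Rightarrow> 'h::{real_inner,complete_space,second_countable_topology}"
  assumes e: "orthonormal_basis e" and c: "0 \<le> c" and le: "\<And>j. \<bar>e j \<bullet> x\<bar> \<le> c * \<bar>e j \<bullet> y\<bar>"
  shows "norm x \<le> c * norm y"
proof (rule power2_le_imp_le)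
  have "(norm x)\<^sup>2 = (\<Sum>k. (e k \<bullet> x)\<^sup>2)" by (simp add: parseval[OF e])
  also have "\<dots> \<le> (\<Sum>k. c\<^sup>2 * (e k \<bullet> y)\<^sup>2)"
  proof (intro suminf_le summable_mult summable_coord_sq[OF e])
    show "(e k \<bullet> x)\<^sup>2 \<le> c\<^sup>2 * (e k \<bullet> y)\<^sup>2" for k
      using power_mono[OF le[of k], of 2] by (simp add: power_mult_distrib)
  qed
  also have "\<dots> = (c * norm y)\<^sup>2"
    by (simp add: suminf_mult summable_coord_sq[OF e] parseval[OF e] power_mult_distrib)
  finally show "(norm x)\<^sup>2 \<le> (c * norm y)\<^sup>2" .
qed (simp add: c)

text \<open>The square of a diagonal entry is one term of the Hilbert-Schmidt series, so it is at
  most 1; a jump of this size never enlarges a coordinate.\<close>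

lemma diag_coord_le:
  fixes e :: "nat \<Rightarrow> 'h::{real_inner,complete_space,second_countable_topology}"
  assumes e: "orthonormal_basis e" and z: "z \<in> diag_HS e" and hs: "hs_norm e z < 1"
  shows "\<bar>e j \<bullet> blinfun_apply z w\<bar> \<le> \<bar>e j \<bullet> w\<bar>"
proof -
  from z obtain d where d: "\<And>k. blinfun_apply z (e k) = d k *\<^sub>R e k"
    unfolding diag_HS_def by (auto dest!: choice)
  have eq: "e j \<bullet> blinfun_apply z w = d j * (e j \<bullet> w)"
  proof (rule basis_functional_eqI[OF e])
    show "bounded_linear (\<lambda>w. e j \<bullet> blinfun_apply z w)"
      by (rule bounded_linear_compose[OF bounded_linear_inner_right blinfun.bounded_linear_right])
    show "bounded_linear (\<lambda>w. d j * (e j \<bullet> w))"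
      by (rule bounded_linear_compose[OF bounded_linear_mult_right bounded_linear_inner_right])
  qed (simp add: d orthonormal_basis_inner[OF e])
  have "(d j)\<^sup>2 = (norm (blinfun_apply z (e j)))\<^sup>2"
    using orthonormal_basis_inner[OF e, of j j] by (simp add: d norm_eq_sqrt_inner)
  also have "\<dots> \<le> (\<Sum>n. (norm (blinfun_apply z (e n)))\<^sup>2)"
    using sum_le_suminf[of "\<lambda>n. (norm (blinfun_apply z (e n)))\<^sup>2" "{j}"] z
    by (simp add: diag_HS_def)
  also have "\<dots> \<le> 1" using hs by (simp add: hs_norm_def)
  finally have "\<bar>d j\<bar> \<le> 1" by (simp add: power2_le_iff_abs_le abs_square_le_1)
  then show ?thesis by (simp add: eq abs_mult mult_left_le_one_le)
qed

section \<open>Gronwall's inequality for right-continuous drivers\<close>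

text \<open>Continuation in time: the set of good times has a supremum that belongs to it and cannot
  lie before \<open>T\<close>. \<open>F\<close> may jump, so no differential form is available; the
  2 in the exponent is the price of absorbing \<open>V t\<close> into the left side when moving past
  a good time.\<close>

lemma gronwall_right_continuous:
  fixes V F :: "real \<Rightarrow> real"
  assumes b: "0 \<le> b" and V0: "V 0 \<le> b" and F0: "0 \<le> F 0" and T: "0 \<le> T"
    and V: "mono_on {0..} V" and F: "mono_on {0..} F"
    and rc: "\<And>t. 0 \<le> t \<Longrightarrow> (F \<longlongrightarrow> F t) (at_right t)"
    and step: "\<And>u t B. 0 \<le> u \<Longrightarrow> u < t \<Longrightarrow> (\<And>r. 0 \<le> r \<Longrightarrow> r < t \<Longrightarrow> V r \<le> B) \<Longrightarrow>
      0 \<le> B \<Longrightarrow> V t - V u \<le> B * (F t - F u)"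
    and Vnn: "\<And>t. 0 \<le> t \<Longrightarrow> 0 \<le> V t"
  shows "V T \<le> b * exp (2 * F T)"
proof -
  define S where "S = {t. 0 \<le> t \<and> t \<le> T \<and> V t \<le> b * exp (2 * F t)}"
  have "b * 1 \<le> b * exp (2 * F 0)" using b F0 by (intro mult_left_mono) auto
  then have S0: "0 \<in> S" using V0 T by (simp add: S_def)
  then have ne: "S \<noteq> {}" by auto
  have bdd: "bdd_above S" by (auto simp: S_def intro!: bdd_aboveI[of _ T])
  define s where "s = Sup S"
  have s0: "0 \<le> s" unfolding s_def using S0 bdd by (rule cSup_upper)
  have sT: "s \<le> T" unfolding s_def using S0 by (intro cSup_least) (auto simp: S_def)
  have ss: "s \<in> S"
  proof (rule ccontr)
    assume ns: "s \<notin> S"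
    \<comment> \<open>Since \<open>s\<close> is not in \<open>S\<close>, all of \<open>S\<close>
      lies strictly below \<open>s\<close>, and \<open>L\<close> plays the role of the left limit of
      \<open>F\<close> at \<open>s\<close>, where \<open>F\<close> may jump.\<close>
    define L where "L = (SUP r\<in>S. F r)"
    have ltS: "r < s" if "r \<in> S" for r
      using cSup_upper[OF that bdd] that ns by (auto simp: s_def[symmetric] less_le)
    have Fs: "F r \<le> F s" if "r \<in> S" for r
      using ltS[OF that] that s0 by (intro mono_onD[OF F]) (auto simp: S_def)
    then have bF: "bdd_above (F ` S)" by (intro bdd_aboveI2)
    have FL: "F r \<le> L" if "r \<in> S" for r
      unfolding L_def using that bF by (rule cSUP_upper)
    have Ls: "L \<le> F s" unfolding L_def using S0 by (intro cSUP_least Fs) auto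
    have VB: "V r \<le> b * exp (2 * L)" if r: "0 \<le> r" "r < s" for r
    proof -
      obtain r' where r': "r' \<in> S" "r < r'"
        using less_cSup_iff[OF ne bdd, of r] r by (auto simp: s_def)
      have "V r \<le> V r'" using r' that by (intro mono_onD[OF V]) (auto simp: S_def)
      also have "\<dots> \<le> b * exp (2 * F r')" using r' by (simp add: S_def)
      also have "\<dots> \<le> b * exp (2 * L)" using FL[OF r'(1)] b by (intro mult_left_mono) auto
      finally show ?thesis .
    qed
    \<comment> \<open>One step from a good time \<open>u\<close> with \<open>F u\<close> close to
      \<open>L\<close> up to \<open>s\<close> takes the whole jump of \<open>F\<close> into account,
      against the bound already valid before \<open>s\<close>.\<close>
    have "V s \<le> b * exp (2 * L) * (1 + F s - L) + b * exp (2 * L) * \<delta>" if d: "0 < \<delta>" for \<delta>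
    proof -
      obtain u where u: "u \<in> S" "L - \<delta> < F u"
        using less_cSUP_iff[OF ne bF, of "L - \<delta>"] d by (auto simp: L_def)
      have "V s \<le> V u + b * exp (2 * L) * (F s - F u)"
        using step[of u s "b * exp (2 * L)"] u ltS[OF u(1)] VB b by (auto simp: S_def)
      also have "V u \<le> b * exp (2 * L)" using VB[of u] u ltS[OF u(1)] by (auto simp: S_def)
      also have "b * exp (2 * L) * (F s - F u) \<le> b * exp (2 * L) * (F s - L + \<delta>)"
        using u b by (intro mult_left_mono) auto
      finally show ?thesis by (simp add: algebra_simps)
    qed
    then have "V s \<le> b * exp (2 * L) * (1 + F s - L) + \<delta>" if "0 < \<delta>" for \<delta>
    proof -
      have pos: "0 < b * exp (2 * L) + 1" using b by (intro add_nonneg_pos) auto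
      have "V s \<le> b * exp (2 * L) * (1 + F s - L) + b * exp (2 * L) * (\<delta> / (b * exp (2 * L) + 1))"
        using \<open>0 < \<delta>\<close> pos by (intro \<open>\<And>\<delta>. 0 < \<delta> \<Longrightarrow> V s \<le> _ + b * exp (2 * L) * \<delta>\<close>) auto
      also have "b * exp (2 * L) * (\<delta> / (b * exp (2 * L) + 1)) \<le> \<delta>"
        using pos that b by (simp add: field_simps)
      finally show ?thesis by simp
    qed
    then have "V s \<le> b * exp (2 * L) * (1 + F s - L)" by (rule field_le_epsilon)
    also have "\<dots> \<le> b * exp (2 * L) * (1 + 2 * (F s - L))"
      using Ls b by (intro mult_left_mono) auto
    also have "b * exp (2 * L) * (1 + 2 * (F s - L)) \<le> b * exp (2 * L) * exp (2 * (F s - L))"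
      using b by (intro mult_left_mono exp_ge_add_one_self) auto
    also have "\<dots> = b * exp (2 * F s)"
      by (simp add: exp_add[symmetric] mult.assoc algebra_simps)
    finally show False using ns s0 sT by (simp add: S_def)
  qed
  have "s = T"
  proof (rule ccontr)
    assume "s \<noteq> T"
    then have sT': "s < T" using sT by simp
    \<comment> \<open>Right continuity yields a later time with a small increment of
      \<open>F\<close>. Before \<open>t\<close> only the bound \<open>V t\<close> itself is at hand,
      so \<open>step\<close> is used with \<open>B = V t\<close>, and an increment below 1/2 lets
      this term be absorbed.\<close>
    have "\<forall>\<^sub>F t in at_right s. F t < F s + 1/2"
      by (rule order_tendstoD(2)[OF rc[OF s0]]) simp
    moreover have "\<forall>\<^sub>F t in at_right s. s < t \<and> t < T"
      using sT' by (auto simp: eventually_at_right[OF sT'])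
    ultimately have "\<forall>\<^sub>F t in at_right s. F t < F s + 1/2 \<and> s < t \<and> t < T"
      by eventually_elim auto
    then obtain t where t: "F t < F s + 1/2" "s < t" "t < T"
      using eventually_happens trivial_limit_at_right_real by blast
    define x where "x = F t - F s"
    have x: "0 \<le> x" "x < 1/2" using t s0 mono_onD[OF F, of s t] by (auto simp: x_def)
    have "V t - V s \<le> V t * x"
      unfolding x_def
    proof (rule step)
      show "V r \<le> V t" if "0 \<le> r" "r < t" for r
        using that by (intro mono_onD[OF V]) auto
    qed (use t s0 Vnn in auto)
    then have "V t * (1 - x) \<le> V s" unfolding right_diff_distrib by linarith
    also have "\<dots> \<le> b * exp (2 * F s)" using ss by (simp add: S_def)
    finally have *: "V t * (1 - x) \<le> b * exp (2 * F s)" .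
    \<comment> \<open>For \<open>x\<close> between 0 and 1/2 this replaces division by
      \<open>1 - x\<close> with the factor \<open>1 + 2 * x\<close>, which is at most
      \<open>exp (2 * x)\<close>.\<close>
    have "(1 - x) * (1 + 2 * x) = 1 + x * (1 - 2 * x)" by (simp add: algebra_simps)
    moreover have "0 \<le> x * (1 - 2 * x)" using x by (intro mult_nonneg_nonneg) auto
    ultimately have "V t * 1 \<le> V t * ((1 - x) * (1 + 2 * x))"
      using Vnn[of t] t s0 by (intro mult_left_mono) auto
    also have "\<dots> = (V t * (1 - x)) * (1 + 2 * x)" by simp
    also have "\<dots> \<le> (b * exp (2 * F s)) * exp (2 * x)"
      by (rule mult_mono[OF * exp_ge_add_one_self]) (use x b in auto)
    also have "\<dots> = b * exp (2 * F t)"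
      unfolding mult.assoc exp_add[symmetric] by (simp add: x_def)
    finally have "t \<in> S" using t s0 by (simp add: S_def)
    then have "t \<le> s" unfolding s_def using bdd by (rule cSup_upper)
    then show False using t by simp
  qed
  then show ?thesis using ss by (simp add: S_def)
qed

section \<open>Pathwise deviation from the semigroup\<close>

text \<open>Dominated convergence with majorant the absolute value of \<open>q\<close>. From the
  left the limit loses the mass at \<open>f p = s\<close>, from the right it keeps it. The first
  serves the left limits of coordinates, the second the right continuity of the driver.\<close>

lemma
  fixes f q :: "'a \<Rightarrow> real"
  assumes q: "integrable R q" and f[measurable]: "f \<in> borel_measurable R"
  shows tendsto_cut_at_left: "((\<lambda>t. \<integral>p. indicator {..t} (f p) * q p \<partial>R) \<longlongrightarrow>
      (\<integral>p. indicator {..<s} (f p) * q p \<partial>R)) (at_left s)" (is ?L)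
    and tendsto_cut_at_right: "((\<lambda>t. \<integral>p. indicator {..t} (f p) * q p \<partial>R) \<longlongrightarrow>
      (\<integral>p. indicator {..s} (f p) * q p \<partial>R)) (at_right s)" (is ?R)
proof -
  have [measurable]: "q \<in> borel_measurable R" using q by simp
  show ?L
  proof (rule tendsto_at_left_sequentially[of "s - 1"])
    fix S :: "nat \<Rightarrow> real" assume S: "\<And>n. S n < s" "S \<longlonglongrightarrow> s"
    show "(\<lambda>n. \<integral>p. indicator {..S n} (f p) * q p \<partial>R) \<longlonglongrightarrow> (\<integral>p. indicator {..<s} (f p) * q p \<partial>R)"
    proof (rule integral_dominated_convergence[where w="\<lambda>p. norm (q p)"])
      show "AE p in R. (\<lambda>n. indicator {..S n} (f p) * q p) \<longlonglongrightarrow> indicator {..<s} (f p) * q p"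
      proof (rule AE_I2)
        fix p
        have "\<forall>\<^sub>F n in sequentially. indicator {..S n} (f p) = (indicator {..<s} (f p) :: real)"
        proof (cases "f p < s")
          case True
          from order_tendstoD(1)[OF S(2) this] show ?thesis
            by eventually_elim (use True in \<open>auto simp: indicator_def\<close>)
        next
          case False
          then have "\<not> f p \<le> S n" for n using S(1)[of n] by auto
          with False show ?thesis by (auto simp: indicator_def)
        qed
        then have "(\<lambda>n. indicator {..S n} (f p) :: real) \<longlonglongrightarrow> indicator {..<s} (f p)"
          by (rule tendsto_eventually)
        then show "(\<lambda>n. indicator {..S n} (f p) * q p) \<longlonglongrightarrow> indicator {..<s} (f p) * q p"
          by (intro tendsto_intros)
      qed
    qed (use q in \<open>auto simp: indicator_def\<close>)
  qed simp
  show ?R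
  proof (rule tendsto_at_right_sequentially[of s "s + 1"])
    fix S :: "nat \<Rightarrow> real" assume S: "\<And>n. s < S n" "S \<longlonglongrightarrow> s"
    show "(\<lambda>n. \<integral>p. indicator {..S n} (f p) * q p \<partial>R) \<longlonglongrightarrow> (\<integral>p. indicator {..s} (f p) * q p \<partial>R)"
    proof (rule integral_dominated_convergence[where w="\<lambda>p. norm (q p)"])
      show "AE p in R. (\<lambda>n. indicator {..S n} (f p) * q p) \<longlonglongrightarrow> indicator {..s} (f p) * q p"
      proof (rule AE_I2)
        fix p
        have "\<forall>\<^sub>F n in sequentially. indicator {..S n} (f p) = (indicator {..s} (f p) :: real)"
        proof (cases "s < f p")
          case True
          from order_tendstoD(2)[OF S(2) this] show ?thesis
            by eventually_elim (use True in \<open>auto simp: indicator_def\<close>)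
        next
          case False
          then have "f p \<le> S n" for n using S(1)[of n] by auto
          with False show ?thesis by (auto simp: indicator_def)
        qed
        then have "(\<lambda>n. indicator {..S n} (f p) :: real) \<longlonglongrightarrow> indicator {..s} (f p)"
          by (rule tendsto_eventually)
        then show "(\<lambda>n. indicator {..S n} (f p) * q p) \<longlonglongrightarrow> indicator {..s} (f p) * q p"
          by (intro tendsto_intros)
      qed
    qed (use q in \<open>auto simp: indicator_def\<close>)
  qed simp
qed

section \<open>Scalar equations for the coordinates\<close>

text \<open>The free weight \<theta> allows two uses: \<open>lam j\<close> gives the exact equation
  of the rescaled coordinate, 0 gives an a priori bound on the coordinate itself.\<close>

definition coord_integrand ::
  "(nat \<Rightarrow> 'h::{real_inner,complete_space,second_countable_topology}) \<Rightarrow> (real \<Rightarrow> 'h) \<Rightarrow> real \<Rightarrow> nat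
     \<Rightarrow> real \<times> ('h \<Rightarrow>\<^sub>L 'h) \<Rightarrow> real" where
  "coord_integrand e x \<theta> j p =
     exp (\<theta> * fst p) * (e j \<bullet> blinfun_apply (snd p) (Lim (at_left (fst p)) x))"

text \<open>The exponential of \<open>- (t - s) * lam j\<close> splits, so that the final time
  \<open>t\<close> survives only in a prefactor and in the domain of integration.\<close>

lemma inner_mild_integrand:
  fixes e :: "nat \<Rightarrow> 'h::{real_inner,complete_space,second_countable_topology}"
  assumes e: "orthonormal_basis e" and lam: "\<And>n. 0 \<le> lam n"
  shows "e j \<bullet> mild_integrand e lam \<eta> x t p =
    exp (- t * lam j) * (indicator ({0..t} \<times> jump_set e \<eta>) p * coord_integrand e x (lam j) j p)"
proof (cases p)
  case (Pair s z)
  show ?thesis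
  proof (cases "p \<in> {0..t} \<times> jump_set e \<eta>")
    case True
    then have "0 \<le> t - s" by (auto simp: Pair)
    then show ?thesis using True
      by (simp add: mild_integrand_def Pair inner_heat_sg[OF e lam] coord_integrand_def
          mult.assoc[symmetric] exp_add[symmetric]) (simp add: algebra_simps)
  qed (simp add: mild_integrand_def Pair)
qed

text \<open>On the bounded window a change of weight is multiplication by a bounded function of
  time. Writing the function as \<open>k p * f p\<close> also settles measurability, which is not
  evident directly because of the left limit inside.\<close>

lemma coord_integrable:
  fixes e :: "nat \<Rightarrow> 'h::{real_inner,complete_space,second_countable_topology}"
  assumes e: "orthonormal_basis e" and lam: "\<And>n. 0 \<le> lam n"
    and R: "sets R = sets (borel \<Otimes>\<^sub>M borel)"
    and int: "integrable R (mild_integrand e lam \<eta> x t)"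
  shows "integrable R (\<lambda>p. indicator ({0..t} \<times> jump_set e \<eta>) p * coord_integrand e x \<theta> j p)"
proof -
  define f where "f p = e j \<bullet> mild_integrand e lam \<eta> x t p" for p
  define k where "k p = indicator {0..t} (fst p) * exp ((\<theta> - lam j) * fst p + t * lam j)"
    for p :: "real \<times> ('h \<Rightarrow>\<^sub>L 'h)"
  have f: "integrable R f" unfolding f_def using int by simp
  have [measurable]: "fst \<in> R \<rightarrow>\<^sub>M borel" using measurable_fst by (simp add: measurable_cong_sets[OF R refl])
  have k: "k \<in> borel_measurable R" unfolding k_def by measurable
  have eq: "indicator ({0..t} \<times> jump_set e \<eta>) p * coord_integrand e x \<theta> j p = k p * f p" for p
  proof (cases "p \<in> {0..t} \<times> jump_set e \<eta>")
    case True
    have "\<theta> * fst p = ((\<theta> - lam j) * fst p + t * lam j) + (- t * lam j + lam j * fst p)"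
      by (simp add: algebra_simps)
    then have "exp (\<theta> * fst p) =
        exp ((\<theta> - lam j) * fst p + t * lam j) * (exp (- t * lam j) * exp (lam j * fst p))"
      by (simp only: exp_add)
    moreover have "fst p \<in> {0..t}" using True by auto
    ultimately show ?thesis using True
      by (simp only: f_def k_def inner_mild_integrand[OF e lam] coord_integrand_def indicator_simps
          mult_1 mult.assoc)
  qed (simp add: f_def inner_mild_integrand[OF e lam])
  have kb: "\<bar>k p\<bar> \<le> exp (\<bar>\<theta> - lam j\<bar> * t + t * lam j)" for p
  proof (cases "fst p \<in> {0..t}")
    case True
    then have "(\<theta> - lam j) * fst p \<le> \<bar>\<theta> - lam j\<bar> * t"
      by (intro mult_mono) auto
    then show ?thesis using True by (simp add: k_def)
  qed (simp add: k_def)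
  show ?thesis unfolding eq
  proof (rule Bochner_Integration.integrable_bound)
    show "integrable R (\<lambda>p. exp (\<bar>\<theta> - lam j\<bar> * t + t * lam j) * f p)" using f by simp
    show "(\<lambda>p. k p * f p) \<in> borel_measurable R" using k f by simp
    show "AE p in R. norm (k p * f p) \<le> norm (exp (\<bar>\<theta> - lam j\<bar> * t + t * lam j) * f p)"
      using kb by (auto simp: abs_mult intro!: mult_right_mono)
  qed
qed

lemma cut_indicator:
  fixes t T c :: real
  shows "t \<le> T \<Longrightarrow> indicator ({0..t} \<times> J) p * c = indicator {..t} (fst p) * (indicator ({0..T} \<times> J) p * c)"
  by (cases p) (auto simp: indicator_def)

text \<open>One realisation is frozen: \<open>P\<close> stands for the random measure at a fixed
  outcome and \<open>Q\<close> for its intensity. The lemmas inside are deterministic; the equation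
  involves the difference of the two measures, the estimates only their sum.\<close>

locale jump_path =
  fixes P Q :: "(real \<times> ('h::{real_inner,complete_space,second_countable_topology} \<Rightarrow>\<^sub>L 'h)) measure"
    and e :: "nat \<Rightarrow> 'h" and lam :: "nat \<Rightarrow> real" and \<eta> \<epsilon> :: real and h :: 'h and x :: "real \<Rightarrow> 'h"
  assumes onb: "orthonormal_basis e" and lam: "\<And>n. 0 \<le> lam n" and eps: "0 \<le> \<epsilon>"
    and jump: "jump_set e \<eta> \<in> sets borel"
    and P: "sets P = sets (borel \<Otimes>\<^sub>M borel)" and Q: "sets Q = sets (borel \<Otimes>\<^sub>M borel)"
    and fin: "\<And>t. emeasure P ({0..t} \<times> jump_set e \<eta>) < \<infinity>" "\<And>t. emeasure Q ({0..t} \<times> jump_set e \<eta>) < \<infinity>"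
    and zero: "AE p in P. fst p \<noteq> 0" "AE p in Q. fst p \<noteq> 0"
    and diag: "AE p in P. snd p \<in> diag_HS e" "AE p in Q. snd p \<in> diag_HS e"
    and int: "\<And>t. 0 \<le> t \<Longrightarrow> integrable P (mild_integrand e lam \<eta> x t)"
      "\<And>t. 0 \<le> t \<Longrightarrow> integrable Q (mild_integrand e lam \<eta> x t)"
    and eq: "\<And>t. 0 \<le> t \<Longrightarrow> x t = heat_sg e lam t h +
      \<epsilon> *\<^sub>R ((\<integral>p. mild_integrand e lam \<eta> x t p \<partial>P) - (\<integral>p. mild_integrand e lam \<eta> x t p \<partial>Q))"
begin

definition A :: "real \<Rightarrow> (real \<times> ('h \<Rightarrow>\<^sub>L 'h)) set" where
  "A t = {0..t} \<times> jump_set e \<eta>"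

definition F :: "real \<Rightarrow> real" where
  "F t = \<epsilon> * (measure P (A t) + measure Q (A t))"

definition g :: "real \<Rightarrow> nat \<Rightarrow> real \<times> ('h \<Rightarrow>\<^sub>L 'h) \<Rightarrow> real" where
  "g = coord_integrand e x"

text \<open>The total variation counterpart of the signed noise term in a coordinate. Absolute
  values make it monotone in time, as the Gronwall lemma requires.\<close>

definition V :: "real \<Rightarrow> nat \<Rightarrow> real \<Rightarrow> real" where
  "V \<theta> j t = \<epsilon> * ((\<integral>p. indicator (A t) p * \<bar>g \<theta> j p\<bar> \<partial>P) + (\<integral>p. indicator (A t) p * \<bar>g \<theta> j p\<bar> \<partial>Q))"

lemma A_sets: "A t \<in> sets P" "A t \<in> sets Q"
  unfolding P Q A_def using jump by auto

lemma fst_measurable: "fst \<in> P \<rightarrow>\<^sub>M borel" "fst \<in> Q \<rightarrow>\<^sub>M borel"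
  using measurable_fst by (simp_all add: measurable_cong_sets[OF P refl] measurable_cong_sets[OF Q refl])

lemma A_integrable: "integrable P (\<lambda>p. indicator (A t) p :: real)" "integrable Q (\<lambda>p. indicator (A t) p :: real)"
  using A_sets fin by (auto simp: A_def integrable_real_indicator)

lemma F_eq: "F t = \<epsilon> * ((\<integral>p. indicator (A t) p \<partial>P) + (\<integral>p. indicator (A t) p \<partial>Q))"
  using A_sets[of t] sets.sets_into_space[OF A_sets(1)[of t]] sets.sets_into_space[OF A_sets(2)[of t]]
  by (simp add: F_def Int_absorb2)

lemma g_integrable:
  assumes "0 \<le> t"
  shows "integrable P (\<lambda>p. indicator (A t) p * g \<theta> j p)" "integrable Q (\<lambda>p. indicator (A t) p * g \<theta> j p)"
  unfolding A_def g_def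
  by (rule coord_integrable[OF onb lam P int(1)[OF assms]],
      rule coord_integrable[OF onb lam Q int(2)[OF assms]])

lemma abs_g_integrable:
  assumes "0 \<le> t"
  shows "integrable P (\<lambda>p. indicator (A t) p * \<bar>g \<theta> j p\<bar>)" "integrable Q (\<lambda>p. indicator (A t) p * \<bar>g \<theta> j p\<bar>)"
  using g_integrable[OF assms, of \<theta> j, THEN integrable_abs] by (auto simp: abs_mult)

lemma coord_eq:
  assumes t: "0 \<le> t"
  shows "e j \<bullet> x t = exp (- t * lam j) * (e j \<bullet> h + \<epsilon> * ((\<integral>p. indicator (A t) p * g (lam j) j p \<partial>P)
     - (\<integral>p. indicator (A t) p * g (lam j) j p \<partial>Q)))"
proof -
  have *: "e j \<bullet> (\<integral>p. mild_integrand e lam \<eta> x t p \<partial>R) =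
      exp (- t * lam j) * (\<integral>p. indicator (A t) p * g (lam j) j p \<partial>R)"
    if "integrable R (mild_integrand e lam \<eta> x t)" for R
  proof -
    have "e j \<bullet> (\<integral>p. mild_integrand e lam \<eta> x t p \<partial>R) = (\<integral>p. e j \<bullet> mild_integrand e lam \<eta> x t p \<partial>R)"
      using that by simp
    then show ?thesis by (simp add: inner_mild_integrand[OF onb lam] A_def g_def)
  qed
  show ?thesis
    by (subst eq[OF t]) (simp add: inner_add_right inner_diff_right *[OF int(1)[OF t]] *[OF int(2)[OF t]]
      inner_heat_sg[OF onb lam t] algebra_simps)
qed

lemma A_mono: "s \<le> t \<Longrightarrow> A s \<subseteq> A t" by (auto simp: A_def)

lemma indicator_A_mono: "s \<le> t \<Longrightarrow> (indicator (A s) p :: real) \<le> indicator (A t) p"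
  using A_mono[of s t] by (auto simp: indicator_def)

lemma F_mono: "mono_on {0..} F"
  unfolding F_eq using eps
  by (intro mono_onI mult_left_mono add_mono integral_mono A_integrable indicator_A_mono) auto

lemma F_nonneg: "0 \<le> F t" using eps by (simp add: F_def)

text \<open>Near \<open>t\<close> the driver is a cut of one fixed integrable indicator, that of
  \<open>A (t + 1)\<close>, so the limit theorem for cuts applies.\<close>

lemma F_right_continuous: "(F \<longlongrightarrow> F t) (at_right t)"
proof -
  have "((\<lambda>u. \<epsilon> * ((\<integral>p. indicator {..u} (fst p) * indicator (A (t + 1)) p \<partial>P) +
        (\<integral>p. indicator {..u} (fst p) * indicator (A (t + 1)) p \<partial>Q))) \<longlongrightarrow>
      \<epsilon> * ((\<integral>p. indicator {..t} (fst p) * indicator (A (t + 1)) p \<partial>P) +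
        (\<integral>p. indicator {..t} (fst p) * indicator (A (t + 1)) p \<partial>Q))) (at_right t)"
    by (intro tendsto_intros tendsto_cut_at_right A_integrable fst_measurable)
  moreover have eqF: "\<epsilon> * ((\<integral>p. indicator {..u} (fst p) * indicator (A (t + 1)) p \<partial>P) +
        (\<integral>p. indicator {..u} (fst p) * indicator (A (t + 1)) p \<partial>Q)) = F u" if "u \<le> t + 1" for u
    using cut_indicator[OF that, where c=1 and J="jump_set e \<eta>"] by (simp add: F_eq A_def)
  moreover have "\<forall>\<^sub>F u in at_right t. u \<le> t + 1"
    by (auto simp: eventually_at_right[of t "t+1"] intro!: exI[of _ "t + 1"])
  ultimately show ?thesis
    by (auto elim!: Lim_transform_eventually eventually_mono)
qed

lemma V_mono: "mono_on {0..} (V \<theta> j)"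
  unfolding V_def using eps
  by (intro mono_onI mult_left_mono add_mono integral_mono abs_g_integrable mult_right_mono indicator_A_mono) auto

lemma V_nonneg: "0 \<le> V \<theta> j t"
  unfolding V_def using eps by (intro mult_nonneg_nonneg add_nonneg_nonneg integral_nonneg_AE) auto

lemma V_0: "V \<theta> j 0 = 0"
proof -
  have "(\<integral>p. indicator (A 0) p * \<bar>g \<theta> j p\<bar> \<partial>P) = (\<integral>p. 0 \<partial>P)"
    using zero(1) abs_g_integrable(1)[of 0 \<theta> j]
    by (intro integral_cong_AE) (auto simp: A_def indicator_def elim!: eventually_mono)
  moreover have "(\<integral>p. indicator (A 0) p * \<bar>g \<theta> j p\<bar> \<partial>Q) = (\<integral>p. 0 \<partial>Q)"
    using zero(2) abs_g_integrable(2)[of 0 \<theta> j]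
    by (intro integral_cong_AE) (auto simp: A_def indicator_def elim!: eventually_mono)
  ultimately show ?thesis by (simp add: V_def)
qed

text \<open>For \<open>fst p \<le> t\<close> and \<open>\<theta> \<le> lam j\<close> the weight
  \<theta> at time \<open>t\<close>, damped at rate \<open>lam j\<close> since the jump, is at most
  the weight \<theta> at the jump time.\<close>

lemma coord_diff_le:
  assumes t: "0 \<le> t" and th: "\<theta> \<le> lam j"
  shows "exp (\<theta> * t) * \<bar>e j \<bullet> x t - exp (- t * lam j) * (e j \<bullet> h)\<bar> \<le> V \<theta> j t"
proof -
  have *: "exp (\<theta> * t) * (exp (- t * lam j) * \<bar>\<integral>p. indicator (A t) p * g (lam j) j p \<partial>R\<bar>) \<le>
      (\<integral>p. indicator (A t) p * \<bar>g \<theta> j p\<bar> \<partial>R)"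
    if 1: "integrable R (\<lambda>p. indicator (A t) p * g (lam j) j p)"
      and 2: "integrable R (\<lambda>p. indicator (A t) p * \<bar>g \<theta> j p\<bar>)" for R
  proof -
    have "exp (\<theta> * t) * (exp (- t * lam j) * \<bar>\<integral>p. indicator (A t) p * g (lam j) j p \<partial>R\<bar>) \<le>
      exp (\<theta> * t) * (exp (- t * lam j) * (\<integral>p. \<bar>indicator (A t) p * g (lam j) j p\<bar> \<partial>R))"
      by (intro mult_left_mono integral_abs_bound) auto
    also have "\<dots> = (\<integral>p. exp (\<theta> * t) * (exp (- t * lam j) * \<bar>indicator (A t) p * g (lam j) j p\<bar>) \<partial>R)"
      using 1 by simp
    also have "\<dots> \<le> (\<integral>p. indicator (A t) p * \<bar>g \<theta> j p\<bar> \<partial>R)"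
    proof (intro integral_mono 2 integrable_mult_right integrable_abs 1)
      fix p
      show "exp (\<theta> * t) * (exp (- t * lam j) * \<bar>indicator (A t) p * g (lam j) j p\<bar>)
         \<le> indicator (A t) p * \<bar>g \<theta> j p\<bar>"
      proof (cases "p \<in> A t")
        case True
        then have "fst p \<le> t" by (auto simp: A_def)
        with th have "0 \<le> (lam j - \<theta>) * (t - fst p)" by (intro mult_nonneg_nonneg) auto
        then have "\<theta> * t + - t * lam j + lam j * fst p \<le> \<theta> * fst p" by (simp add: algebra_simps)
        then have "exp (\<theta> * t) * exp (- t * lam j) * exp (lam j * fst p) \<le> exp (\<theta> * fst p)"
          unfolding exp_add[symmetric] by simp
        from mult_right_mono[OF this, of "\<bar>e j \<bullet> blinfun_apply (snd p) (Lim (at_left (fst p)) x)\<bar>"]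
        show ?thesis using True by (simp add: g_def coord_integrand_def abs_mult mult.assoc)
      qed simp
    qed
    finally show ?thesis .
  qed
  let ?GP = "\<integral>p. indicator (A t) p * g (lam j) j p \<partial>P" and ?GQ = "\<integral>p. indicator (A t) p * g (lam j) j p \<partial>Q"
  have "exp (\<theta> * t) * \<bar>e j \<bullet> x t - exp (- t * lam j) * (e j \<bullet> h)\<bar> =
      exp (\<theta> * t) * \<bar>exp (- t * lam j) * (\<epsilon> * (?GP - ?GQ))\<bar>"
    by (simp add: coord_eq[OF t] distrib_left)
  also have "\<dots> = \<epsilon> * (exp (\<theta> * t) * (exp (- t * lam j) * \<bar>?GP - ?GQ\<bar>))"
    using eps by (simp add: abs_mult)
  also have "\<dots> \<le> \<epsilon> * (exp (\<theta> * t) * (exp (- t * lam j) * (\<bar>?GP\<bar> + \<bar>?GQ\<bar>)))"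
    using eps by (intro mult_left_mono) auto
  also have "\<dots> \<le> V \<theta> j t"
    unfolding V_def distrib_left
    using eps g_integrable[OF t] abs_g_integrable[OF t]
    by (intro add_mono mult_left_mono *) auto
  finally show ?thesis .
qed

text \<open>The hypothesis \<open>left\<close> isolates all that is needed about
  \<open>Lim (at_left s) x\<close>. The argument can thus run twice: once before left limits are
  known to exist, with an enlarged \<open>b\<close>, and once afterwards with the sharp
  \<open>b\<close>.\<close>

lemma coord_gronwall:
  assumes t: "0 \<le> t" and th: "\<theta> \<le> lam j" and b: "\<bar>e j \<bullet> h\<bar> \<le> b" "0 \<le> \<theta>"
    and left: "\<And>s B. 0 < s \<Longrightarrow> b \<le> B \<Longrightarrow> (\<And>r. 0 \<le> r \<Longrightarrow> r < s \<Longrightarrow> exp (\<theta> * r) * \<bar>e j \<bullet> x r\<bar> \<le> B) \<Longrightarrow>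
      exp (\<theta> * s) * \<bar>e j \<bullet> Lim (at_left s) x\<bar> \<le> B"
  shows "b + V \<theta> j t \<le> b * exp (2 * F t)"
    and "exp (\<theta> * t) * \<bar>e j \<bullet> x t\<bar> \<le> b + V \<theta> j t"
proof -
  have bound: "exp (\<theta> * r) * \<bar>e j \<bullet> x r\<bar> \<le> b + V \<theta> j r" if r: "0 \<le> r" for r
  proof -
    have "0 \<le> r * (lam j - \<theta>)" using th r by (intro mult_nonneg_nonneg) auto
    then have "exp (\<theta> * r) * exp (- r * lam j) \<le> 1"
      unfolding exp_add[symmetric] by (simp add: algebra_simps)
    then have "exp (\<theta> * r) * exp (- r * lam j) * \<bar>e j \<bullet> h\<bar> \<le> 1 * b"
      using b by (intro mult_mono) auto
    moreover have "exp (\<theta> * r) * \<bar>e j \<bullet> x r\<bar> \<le>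
        exp (\<theta> * r) * (\<bar>e j \<bullet> x r - exp (- r * lam j) * (e j \<bullet> h)\<bar> + \<bar>exp (- r * lam j) * (e j \<bullet> h)\<bar>)"
      by (intro mult_left_mono) auto
    ultimately show ?thesis
      using coord_diff_le[OF r th] by (simp add: distrib_left abs_mult mult.assoc)
  qed
  show "exp (\<theta> * t) * \<bar>e j \<bullet> x t\<bar> \<le> b + V \<theta> j t" by (rule bound[OF t])
  show "b + V \<theta> j t \<le> b * exp (2 * F t)"
  \<comment> \<open>Adding \<open>b\<close> to \<open>V\<close> makes the function start at
    \<open>b\<close> and dominate the weighted coordinate, so that its increments are controlled by
    its own past.\<close>
  proof (rule gronwall_right_continuous[where V="\<lambda>t. b + V \<theta> j t"])
    fix u t' B assume ut: "0 \<le> u" "u < t'" and B: "\<And>r. 0 \<le> r \<Longrightarrow> r < t' \<Longrightarrow> b + V \<theta> j r \<le> B" "0 \<le> B"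
    have t': "0 \<le> t'" using ut by simp
    \<comment> \<open>The assumption \<open>left\<close> asks for \<open>b \<le> B\<close>; the
      value at time 0, where \<open>V\<close> vanishes, supplies it.\<close>
    have bB: "b \<le> B" using B(1)[of 0] ut V_0[of \<theta> j] by simp
    have w: "exp (\<theta> * s) * \<bar>e j \<bullet> Lim (at_left s) x\<bar> \<le> B" if "0 < s" "s \<le> t'" for s
      using that by (intro left bB order_trans[OF bound B(1)]) auto
    have *: "(\<integral>p. indicator (A t') p * \<bar>g \<theta> j p\<bar> \<partial>R) - (\<integral>p. indicator (A u) p * \<bar>g \<theta> j p\<bar> \<partial>R)
        \<le> B * ((\<integral>p. indicator (A t') p \<partial>R) - (\<integral>p. indicator (A u) p \<partial>R))"
      if 1: "\<And>t. 0 \<le> t \<Longrightarrow> integrable R (\<lambda>p. indicator (A t) p * \<bar>g \<theta> j p\<bar>)"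
        and 2: "\<And>t. integrable R (\<lambda>p. indicator (A t) p :: real)"
        and d: "AE p in R. snd p \<in> diag_HS e" for R
    proof -
      have "(\<integral>p. indicator (A t') p * \<bar>g \<theta> j p\<bar> - indicator (A u) p * \<bar>g \<theta> j p\<bar> \<partial>R)
          \<le> (\<integral>p. B * (indicator (A t') p - indicator (A u) p) \<partial>R)"
      proof (rule integral_mono_AE)
        show "AE p in R. indicator (A t') p * \<bar>g \<theta> j p\<bar> - indicator (A u) p * \<bar>g \<theta> j p\<bar>
          \<le> B * (indicator (A t') p - indicator (A u) p)"
          using d
        proof eventually_elim
          case (elim p)
          show ?case
          proof (cases "p \<in> A t' - A u")
            \<comment> \<open>The jump occurs after \<open>u\<close>, hence at a positive time, and
              has norm below 1: it contracts the coordinate of the left limit, which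
              \<open>w\<close> bounds.\<close>
            case True
            then have s: "0 < fst p" "fst p \<le> t'" and z: "hs_norm e (snd p) < 1"
              using ut by (auto simp: A_def jump_set_def)
            have "\<bar>g \<theta> j p\<bar> \<le> exp (\<theta> * fst p) * \<bar>e j \<bullet> Lim (at_left (fst p)) x\<bar>"
              using diag_coord_le[OF onb elim z] by (simp add: g_def coord_integrand_def abs_mult)
            also have "\<dots> \<le> B" by (rule w[OF s])
            finally show ?thesis using True by simp
          next
            case False
            then have "indicator (A t') p = (indicator (A u) p :: real)"
              using A_mono[of u t'] ut by (auto simp: indicator_def)
            then show ?thesis by simp
          qed
        qed
      qed (use 1 2 t' ut in auto)
      then show ?thesis using 1[OF t'] 1[OF ut(1)] 2 by simp
    qed
    have "(b + V \<theta> j t') - (b + V \<theta> j u) =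
       \<epsilon> * (((\<integral>p. indicator (A t') p * \<bar>g \<theta> j p\<bar> \<partial>P) - (\<integral>p. indicator (A u) p * \<bar>g \<theta> j p\<bar> \<partial>P)) +
         ((\<integral>p. indicator (A t') p * \<bar>g \<theta> j p\<bar> \<partial>Q) - (\<integral>p. indicator (A u) p * \<bar>g \<theta> j p\<bar> \<partial>Q)))"
      by (simp add: V_def algebra_simps)
    also have "\<dots> \<le> \<epsilon> * (B * ((\<integral>p. indicator (A t') p \<partial>P) - (\<integral>p. indicator (A u) p \<partial>P)) +
        B * ((\<integral>p. indicator (A t') p \<partial>Q) - (\<integral>p. indicator (A u) p \<partial>Q)))"
      using eps by (intro mult_left_mono add_mono * abs_g_integrable A_integrable diag)
    also have "\<dots> = B * (F t' - F u)" unfolding F_eq by (simp only: algebra_simps)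
    finally show "(b + V \<theta> j t') - (b + V \<theta> j u) \<le> B * (F t' - F u)" .
  qed (use b t V_0 V_nonneg V_mono F_nonneg F_mono F_right_continuous in \<open>auto simp: mono_on_def\<close>)
qed

section \<open>Left limits of the path\<close>

text \<open>Up to \<open>s\<close> each coordinate is built from exponentials and cuts of a fixed
  integrable function \<open>q\<close>. Such cuts have left limits whatever value
  \<open>Lim (at_left r) x\<close> takes inside \<open>q\<close>, so there is no
  circularity.\<close>

lemma coord_left_limit:
  assumes s: "0 < s"
  obtains l where "((\<lambda>r. e j \<bullet> x r) \<longlongrightarrow> l) (at_left s)"
proof -
  have ev: "\<forall>\<^sub>F r in at_left s. 0 \<le> r \<and> r \<le> s"
    using s by (auto simp: eventually_at_left[OF s])
  define q where "q p = indicator (A s) p * g (lam j) j p" for p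
  define G where "G R r = (\<integral>p. indicator {..r} (fst p) * q p \<partial>R)" for R r
  have q: "integrable P q" "integrable Q q"
    unfolding q_def using s by (auto intro!: g_integrable)
  have "((\<lambda>r. exp (- r * lam j) * (e j \<bullet> h + \<epsilon> * (G P r - G Q r))) \<longlongrightarrow>
      exp (- s * lam j) * (e j \<bullet> h + \<epsilon> * ((\<integral>p. indicator {..<s} (fst p) * q p \<partial>P) -
        (\<integral>p. indicator {..<s} (fst p) * q p \<partial>Q)))) (at_left s)"
    unfolding G_def by (intro tendsto_intros tendsto_cut_at_left q fst_measurable)
  moreover have "\<forall>\<^sub>F r in at_left s. exp (- r * lam j) * (e j \<bullet> h + \<epsilon> * (G P r - G Q r)) = e j \<bullet> x r"
    using ev
  proof eventually_elim
    case (elim r)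
    then have "G R r = (\<integral>p. indicator (A r) p * g (lam j) j p \<partial>R)" for R
      unfolding G_def q_def A_def by (simp only: cut_indicator[of r s, symmetric])
    then show ?case using elim by (simp add: coord_eq)
  qed
  ultimately have "((\<lambda>r. e j \<bullet> x r) \<longlongrightarrow>
      exp (- s * lam j) * (e j \<bullet> h + \<epsilon> * ((\<integral>p. indicator {..<s} (fst p) * q p \<partial>P) -
        (\<integral>p. indicator {..<s} (fst p) * q p \<partial>Q)))) (at_left s)"
    by (rule Lim_transform_eventually)
  then show thesis by (rule that)
qed

lemma left_limit_le:
  assumes l: "(x \<longlongrightarrow> l) (at_left s)" and s: "0 < s"
    and B: "\<And>r. 0 \<le> r \<Longrightarrow> r < s \<Longrightarrow> exp (\<theta> * r) * \<bar>e j \<bullet> x r\<bar> \<le> B"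
  shows "exp (\<theta> * s) * \<bar>e j \<bullet> l\<bar> \<le> B"
proof (rule tendsto_upperbound)
  show "((\<lambda>r. exp (\<theta> * r) * \<bar>e j \<bullet> x r\<bar>) \<longlongrightarrow> exp (\<theta> * s) * \<bar>e j \<bullet> l\<bar>) (at_left s)"
    by (intro tendsto_intros l)
  show "\<forall>\<^sub>F r in at_left s. exp (\<theta> * r) * \<bar>e j \<bullet> x r\<bar> \<le> B"
    unfolding eventually_at_left[OF s] using s by (intro exI[of _ 0]) (auto intro: B)
qed simp

text \<open>A priori, \<open>Lim (at_left s) x\<close> may be the fixed junk vector \<open>THE l. False\<close>; charging its
  coordinates to the initial datum gives a bound on the coordinates that is uniform enough to force the
  existence of the left limits.\<close>

lemma coord_dominated:
  assumes t: "0 \<le> t"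
  shows "\<bar>e j \<bullet> x t\<bar> \<le> (\<bar>e j \<bullet> h\<bar> + \<bar>e j \<bullet> (THE l. False)\<bar>) * exp (2 * F t)"
proof -
  let ?b = "\<bar>e j \<bullet> h\<bar> + \<bar>e j \<bullet> (THE l. False)\<bar>"
  have left: "exp (0 * s) * \<bar>e j \<bullet> Lim (at_left s) x\<bar> \<le> B"
    if s: "0 < s" and B: "?b \<le> B" "\<And>r. 0 \<le> r \<Longrightarrow> r < s \<Longrightarrow> exp (0 * r) * \<bar>e j \<bullet> x r\<bar> \<le> B" for s B
  proof (cases "\<exists>l. (x \<longlongrightarrow> l) (at_left s)")
    case True
    then obtain l where l: "(x \<longlongrightarrow> l) (at_left s)" by blast
    show ?thesis using left_limit_le[OF l s B(2)] tendsto_Lim[OF _ l] by simp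
  next
    case False
    then have "(\<lambda>l. (x \<longlongrightarrow> l) (at_left s)) = (\<lambda>l. False)" by auto
    then have "Lim (at_left s) x = (THE l. False)" unfolding t2_space_class.Lim_def by (rule arg_cong[where f=The])
    then show ?thesis using B(1) by simp
  qed
  have "0 \<le> lam j" "\<bar>e j \<bullet> h\<bar> \<le> ?b" "(0::real) \<le> 0" using lam by auto
  from coord_gronwall[OF t this left] show ?thesis by simp
qed

text \<open>Coordinatewise limits alone do not give convergence in norm; the a priori bound supplies
  a square-summable majorant, uniform on the time window, and Tannery's theorem applied to the
  Parseval series does the rest.\<close>

lemma left_limit_exists:
  assumes s: "0 < s"
  shows "\<exists>l. (x \<longlongrightarrow> l) (at_left s)"
proof -
  have "\<forall>j. \<exists>l. ((\<lambda>r. e j \<bullet> x r) \<longlongrightarrow> l) (at_left s)"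
    using coord_left_limit[OF s] by metis
  then obtain l where l: "\<And>j. ((\<lambda>r. e j \<bullet> x r) \<longlongrightarrow> l j) (at_left s)" by metis
  define c where "c = (THE l::'h. False)"
  define b where "b j = (\<bar>e j \<bullet> h\<bar> + \<bar>e j \<bullet> c\<bar>) * exp (2 * F s)" for j
  have xb: "\<bar>e j \<bullet> x r\<bar> \<le> b j" if "0 \<le> r" "r \<le> s" for j r
  proof -
    have "\<bar>e j \<bullet> x r\<bar> \<le> (\<bar>e j \<bullet> h\<bar> + \<bar>e j \<bullet> c\<bar>) * exp (2 * F r)"
      unfolding c_def by (rule coord_dominated[OF that(1)])
    also have "\<dots> \<le> b j" unfolding b_def
      using mono_onD[OF F_mono, of r s] that by (intro mult_left_mono) auto
    finally show ?thesis .
  qed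
  have ev: "\<forall>\<^sub>F r in at_left s. 0 \<le> r \<and> r \<le> s"
    using s by (auto simp: eventually_at_left[OF s])
  have lb: "\<bar>l j\<bar> \<le> b j" for j
    by (rule tendsto_upperbound[OF tendsto_rabs[OF l]]) (use ev in eventually_elim, auto intro: xb)
  \<comment> \<open>The junk value \<open>c\<close> is still a vector of the Hilbert space, so its
    coordinates are square-summable like those of \<open>h\<close>.\<close>
  have b2: "summable (\<lambda>j. (b j)\<^sup>2)"
  proof (rule summable_comparison_test')
    show "summable (\<lambda>j. (2 * (e j \<bullet> h)\<^sup>2 + 2 * (e j \<bullet> c)\<^sup>2) * (exp (2 * F s))\<^sup>2)"
      by (intro summable_mult2 summable_add summable_mult summable_coord_sq onb)
    fix j
    have "(\<bar>e j \<bullet> h\<bar> + \<bar>e j \<bullet> c\<bar>)\<^sup>2 \<le> 2 * (e j \<bullet> h)\<^sup>2 + 2 * (e j \<bullet> c)\<^sup>2"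
      using sum_squares_bound[of "\<bar>e j \<bullet> h\<bar>" "\<bar>e j \<bullet> c\<bar>"] by (simp add: power2_sum)
    then show "norm ((b j)\<^sup>2) \<le> (2 * (e j \<bullet> h)\<^sup>2 + 2 * (e j \<bullet> c)\<^sup>2) * (exp (2 * F s))\<^sup>2"
      by (simp add: b_def power_mult_distrib mult_right_mono)
  qed
  have l2: "summable (\<lambda>j. (l j)\<^sup>2)"
    by (rule summable_comparison_test'[OF b2]) (use lb in \<open>auto intro: power2_le_iff_abs_le simp: abs_le_square_iff[symmetric] order_trans[OF lb]\<close>)
  define L where "L = (\<Sum>j. l j *\<^sub>R e j)"
  have eL: "e j \<bullet> L = l j" for j unfolding L_def by (rule inner_suminf_orthonormal[OF onb l2])
  have "((\<lambda>r. \<Sum>j. (e j \<bullet> (x r - L))\<^sup>2) \<longlongrightarrow> (\<Sum>j::nat. 0)) (at_left s)"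
  proof (rule tannerys_theorem[THEN conjunct2, THEN conjunct2])
    show "((\<lambda>r. (e j \<bullet> (x r - L))\<^sup>2) \<longlongrightarrow> 0) (at_left s)" for j
      using tendsto_power[OF tendsto_diff[OF l[of j] tendsto_const[of "l j"]], of 2]
      by (simp add: inner_diff_right eL)
    have "norm ((e j \<bullet> (x r - L))\<^sup>2) \<le> 4 * (b j)\<^sup>2" if "0 \<le> r \<and> r \<le> s" for j r
    proof -
      have "\<bar>e j \<bullet> (x r - L)\<bar> \<le> 2 * b j"
        using xb[of r j] lb[of j] that by (auto simp: inner_diff_right eL)
      from power_mono[OF this, of 2] show ?thesis by (simp add: power_mult_distrib)
    qed
    then show "\<forall>\<^sub>F (j, r) in sequentially \<times>\<^sub>F at_left s. norm ((e j \<bullet> (x r - L))\<^sup>2) \<le> 4 * (b j)\<^sup>2"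
      using ev by (auto simp: case_prod_unfold eventually_prod_filter intro!: exI[of _ "\<lambda>_. True"] exI[of _ "\<lambda>r. 0 \<le> r \<and> r \<le> s"])
    show "summable (\<lambda>j. 4 * (b j)\<^sup>2)" by (intro summable_mult b2)
  qed simp
  then have "((\<lambda>r. (norm (x r - L))\<^sup>2) \<longlongrightarrow> 0) (at_left s)" by (simp add: parseval[OF onb])
  then have "((\<lambda>r. sqrt ((norm (x r - L))\<^sup>2)) \<longlongrightarrow> sqrt 0) (at_left s)" by (rule tendsto_real_sqrt)
  then have "(x \<longlongrightarrow> L) (at_left s)" by (simp add: tendsto_norm_zero_iff LIM_zero_iff)
  then show ?thesis by blast
qed

text \<open>Second run of Gronwall, now with weight \<open>lam j\<close> and \<open>b\<close> equal
  to the absolute value of \<open>e j \<bullet> h\<close>. The factor obtained is the same for all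
  \<open>j\<close> and thus passes to the norm.\<close>

lemma path_deviation:
  assumes t: "0 \<le> t"
  shows "norm (x t - heat_sg e lam t h) \<le> (exp (2 * F t) - 1) * norm (heat_sg e lam t h)"
proof (rule norm_le_coord[OF onb])
  show "0 \<le> exp (2 * F t) - 1" using F_nonneg by simp
  fix j
  have left: "exp (lam j * s) * \<bar>e j \<bullet> Lim (at_left s) x\<bar> \<le> B"
    if s: "0 < s" and B: "\<And>r. 0 \<le> r \<Longrightarrow> r < s \<Longrightarrow> exp (lam j * r) * \<bar>e j \<bullet> x r\<bar> \<le> B" for s B
  proof -
    obtain l where l: "(x \<longlongrightarrow> l) (at_left s)" using left_limit_exists[OF s] by blast
    show ?thesis using left_limit_le[OF l s B] tendsto_Lim[OF _ l] by simp
  qed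
  have V: "V (lam j) j t \<le> \<bar>e j \<bullet> h\<bar> * (exp (2 * F t) - 1)"
    using coord_gronwall(1)[OF t order_refl order_refl lam left] by (simp add: algebra_simps)
  have "\<bar>e j \<bullet> x t - exp (- t * lam j) * (e j \<bullet> h)\<bar> =
      exp (- t * lam j) * (exp (lam j * t) * \<bar>e j \<bullet> x t - exp (- t * lam j) * (e j \<bullet> h)\<bar>)"
    unfolding mult.assoc[symmetric] exp_add[symmetric] by (simp add: mult.commute)
  also have "\<dots> \<le> exp (- t * lam j) * (\<bar>e j \<bullet> h\<bar> * (exp (2 * F t) - 1))"
    using order_trans[OF coord_diff_le[OF t order_refl] V] by (intro mult_left_mono) auto
  finally show "\<bar>e j \<bullet> (x t - heat_sg e lam t h)\<bar> \<le> (exp (2 * F t) - 1) * \<bar>e j \<bullet> heat_sg e lam t h\<bar>"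
    by (simp add: inner_diff_right inner_heat_sg[OF onb lam t] abs_mult mult_ac)
qed

end

section \<open>Poisson random measures and the jump measure\<close>

text \<open>The probabilities of the finite counts add up to 1, leaving none for the value
  \<infinity>. Off that null event the exponential is a sum over the counts, integrated term by term
  into an exponential series.\<close>

lemma
  assumes M: "prob_space M" and N: "poisson_random_measure M \<mu> N"
    and B: "B \<in> sets \<mu>" "emeasure \<mu> B < \<infinity>"
  shows poisson_finite: "AE \<omega> in M. emeasure (N \<omega>) B < \<infinity>"
    and poisson_exp_moment: "(\<integral>\<^sup>+ \<omega>. ennreal (exp (\<beta> * measure (N \<omega>) B)) \<partial>M)
      = ennreal (exp (measure \<mu> B * (exp \<beta> - 1)))"
proof -
  interpret prob_space M by fact
  define E where "E n = {\<omega>\<in>space M. emeasure (N \<omega>) B = of_nat n}" for n :: nat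
  define m where "m = measure \<mu> B"
  have meas: "(\<lambda>\<omega>. emeasure (N \<omega>) B) \<in> borel_measurable M"
    using N B unfolding poisson_random_measure_def by blast
  have E: "E n \<in> sets M" for n
    unfolding E_def using meas by measurable
  have pE: "prob (E n) = m ^ n / fact n * exp (- m)" for n
    using N B unfolding poisson_random_measure_def E_def m_def by blast
  have disj: "disjoint_family E"
    by (auto simp: disjoint_family_on_def E_def)
  have expsum: "(\<lambda>n. y ^ n / fact n) sums exp y" for y :: real
    using exp_converges[of y] by (simp add: field_simps scaleR_conv_of_real)
  have "(\<lambda>n. prob (E n)) sums prob (\<Union>n. E n)"
    using E disj by (intro finite_measure_UNION) auto
  moreover have "(\<lambda>n. prob (E n)) sums (exp m * exp (- m))"
    unfolding pE by (intro sums_mult2 expsum)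
  ultimately have "prob (\<Union>n. E n) = 1"
    by (simp add: sums_unique2 exp_minus_inverse)
  then have AE: "AE \<omega> in M. \<omega> \<in> (\<Union>n. E n)" by (rule AE_prob_1)
  then show "AE \<omega> in M. emeasure (N \<omega>) B < \<infinity>"
    by eventually_elim (auto simp: E_def of_nat_less_top)
  have "(\<integral>\<^sup>+ \<omega>. ennreal (exp (\<beta> * measure (N \<omega>) B)) \<partial>M)
      = (\<integral>\<^sup>+ \<omega>. (\<Sum>n. ennreal (exp (\<beta> * real n)) * indicator (E n) \<omega>) \<partial>M)"
  proof (rule nn_integral_cong_AE)
    show "AE \<omega> in M. ennreal (exp (\<beta> * measure (N \<omega>) B)) = (\<Sum>n. ennreal (exp (\<beta> * real n)) * indicator (E n) \<omega>)"
      using AE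
    proof eventually_elim
      case (elim \<omega>)
      then obtain k where k: "\<omega> \<in> E k" by auto
      then have "measure (N \<omega>) B = real k"
        by (simp add: E_def measure_def)
      moreover have "(\<Sum>n. ennreal (exp (\<beta> * real n)) * indicator (E n) \<omega>)
          = (\<Sum>n\<in>{k}. ennreal (exp (\<beta> * real n)) * indicator (E n) \<omega>)"
        using k by (intro suminf_finite) (auto simp: E_def indicator_def)
      ultimately show ?case using k by simp
    qed
  qed
  also have "\<dots> = (\<Sum>n. \<integral>\<^sup>+ \<omega>. ennreal (exp (\<beta> * real n)) * indicator (E n) \<omega> \<partial>M)"
    using E by (intro nn_integral_suminf) auto
  also have "\<dots> = (\<Sum>n. ennreal ((exp \<beta> * m) ^ n / fact n * exp (- m)))"
  proof (intro arg_cong[where f=suminf] ext)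
    fix n
    have "(\<integral>\<^sup>+ \<omega>. ennreal (exp (\<beta> * real n)) * indicator (E n) \<omega> \<partial>M) = ennreal (exp (\<beta> * real n) * prob (E n))"
      using E by (simp add: nn_integral_cmult emeasure_eq_measure ennreal_mult)
    also have "exp (\<beta> * real n) * prob (E n) = (exp \<beta> * m) ^ n / fact n * exp (- m)"
      by (simp add: pE power_mult_distrib exp_of_nat_mult[symmetric] mult.commute)
    finally show "(\<integral>\<^sup>+ \<omega>. ennreal (exp (\<beta> * real n)) * indicator (E n) \<omega> \<partial>M) =
        ennreal ((exp \<beta> * m) ^ n / fact n * exp (- m))" .
  qed
  also have "\<dots> = ennreal (exp (exp \<beta> * m) * exp (- m))"
    by (intro suminf_ennreal_eq sums_mult2 expsum) (auto simp: m_def)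
  also have "exp (exp \<beta> * m) * exp (- m) = exp (m * (exp \<beta> - 1))"
    unfolding exp_add[symmetric] by (simp add: algebra_simps)
  finally show "(\<integral>\<^sup>+ \<omega>. ennreal (exp (\<beta> * measure (N \<omega>) B)) \<partial>M)
      = ennreal (exp (measure \<mu> B * (exp \<beta> - 1)))" by (simp add: m_def)
qed

text \<open>With mean 0 the count 0 has probability 1. This excludes atoms at time 0 and atoms at
  non-diagonal operators.\<close>

lemma poisson_null:
  assumes M: "prob_space M" and N: "poisson_random_measure M \<mu> N"
    and B: "B \<in> sets \<mu>" "emeasure \<mu> B = 0"
  shows "AE \<omega> in M. emeasure (N \<omega>) B = 0"
proof -
  interpret prob_space M by fact
  have fin: "emeasure \<mu> B < \<infinity>" using B by simp
  have "prob {\<omega>\<in>space M. emeasure (N \<omega>) B = of_nat 0} = measure \<mu> B ^ 0 / fact 0 * exp (- measure \<mu> B)"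
    using N B(1) fin unfolding poisson_random_measure_def by blast
  then have "prob {\<omega>\<in>space M. emeasure (N \<omega>) B = 0} = 1"
    using B by (simp add: measure_def)
  from AE_prob_1[OF this] show ?thesis by auto
qed

section \<open>The Hilbert-Schmidt norm and the jump measure\<close>

lemma hs_norm_measurable [measurable]: "hs_norm e \<in> borel_measurable borel"
proof -
  have [measurable]: "(\<lambda>z. blinfun_apply z x) \<in> borel_measurable borel" for x :: 'a
    by (intro borel_measurable_continuous_onI continuous_intros)
  show ?thesis unfolding hs_norm_def[abs_def] by measurable
qed

lemma jump_set_measurable: "jump_set e \<eta> \<in> sets borel"
  unfolding jump_set_def by measurable

text \<open>Markov's inequality for the function whose integral a Levy measure makes finite.\<close>

lemma levy_measure_finite:
  assumes "levy_measure e \<nu>" "S \<in> sets borel" "0 < c" "\<And>z. z \<in> S \<Longrightarrow> c \<le> min 1 ((hs_norm e z)\<^sup>2)"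
  shows "emeasure \<nu> S < \<infinity>"
proof -
  have S: "S \<in> sets \<nu>" using assms by (simp add: levy_measure_def)
  have "ennreal c * emeasure \<nu> S = (\<integral>\<^sup>+ z. ennreal c * indicator S z \<partial>\<nu>)"
    using S by (simp add: nn_integral_cmult)
  also have "\<dots> \<le> (\<integral>\<^sup>+ z. ennreal (min 1 ((hs_norm e z)\<^sup>2)) \<partial>\<nu>)"
    using assms(4) by (intro nn_integral_mono) (auto simp: indicator_def intro!: ennreal_leI)
  also have "\<dots> < \<infinity>" using assms(1) by (simp add: levy_measure_def)
  finally show ?thesis using assms(3) by (auto simp: ennreal_mult_less_top)
qed

text \<open>Exhaustion by \<open>{0}\<close>, a null set covering the non-diagonal operators, and
  level sets of finite mass. It is needed to evaluate \<open>intensity \<nu>\<close> on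
  rectangles.\<close>

lemma levy_measure_sigma_finite:
  fixes e :: "nat \<Rightarrow> 'h::{real_inner,complete_space,second_countable_topology}"
  assumes e: "orthonormal_basis e" and L: "levy_measure e \<nu>" and D: "AE z in \<nu>. z \<in> diag_HS e"
  shows "sigma_finite_measure \<nu>"
proof
  have sets: "sets \<nu> = sets borel" and z0: "emeasure \<nu> {0} = 0"
    using L by (auto simp: levy_measure_def)
  have sp: "space \<nu> = UNIV" using sets_eq_imp_space_eq[OF sets] by simp
  from D obtain Z where Z: "Z \<in> null_sets \<nu>" "{z. z \<notin> diag_HS e} \<subseteq> Z"
    by (auto simp: eventually_ae_filter sp)
  define S where "S n = {z. inverse (real (Suc n)) \<le> min 1 ((hs_norm e z)\<^sup>2)}" for n
  have S: "S n \<in> sets borel" for n unfolding S_def by measurable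
  have fin: "emeasure \<nu> (S n) < \<infinity>" for n
    by (rule levy_measure_finite[OF L S, of "inverse (real (Suc n))"]) (auto simp: S_def)
  have U: "z \<in> \<Union> (insert Z (insert {0} (range S)))" for z
  proof (rule ccontr)
    assume *: "z \<notin> \<Union> (insert Z (insert {0} (range S)))"
    then have z: "z \<in> diag_HS e" "z \<noteq> 0" using Z by auto
    have "hs_norm e z = 0"
    proof (rule ccontr)
      assume "hs_norm e z \<noteq> 0"
      then have "0 < min 1 ((hs_norm e z)\<^sup>2)" by simp
      then obtain n where "inverse (real (Suc n)) < min 1 ((hs_norm e z)\<^sup>2)"
        using reals_Archimedean by blast
      then have "z \<in> S n" by (simp add: S_def)
      then show False using * by blast
    qed
    \<comment> \<open>Summability comes from \<open>diag_HS\<close>; only with it does the value 0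
      of the series force every term to vanish, and then \<open>z\<close> itself.\<close>
    then have "(\<Sum>n. (norm (blinfun_apply z (e n)))\<^sup>2) = 0" by (simp add: hs_norm_def)
    then have ze: "blinfun_apply z (e n) = 0" for n
      using suminf_eq_zero_iff[of "\<lambda>n. (norm (blinfun_apply z (e n)))\<^sup>2"] z by (simp add: diag_HS_def)
    have "blinfun_apply z w = 0" for w
    proof (rule basis_eqI[OF e])
      fix k
      show "e k \<bullet> blinfun_apply z w = e k \<bullet> 0"
        by (rule basis_functional_eqI[OF e])
          (auto simp: ze intro: bounded_linear_compose[OF bounded_linear_inner_right blinfun.bounded_linear_right])
    qed
    then have "z = 0" by (intro blinfun_eqI) simp
    then show False using z by simp
  qed
  show "\<exists>A. countable A \<and> A \<subseteq> sets \<nu> \<and> \<Union> A = space \<nu> \<and> (\<forall>a\<in>A. emeasure \<nu> a \<noteq> \<infinity>)"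
  proof (intro exI[of _ "insert Z (insert {0} (range S))"] conjI ballI)
    show "\<Union> (insert Z (insert {0} (range S))) = space \<nu>" using U unfolding sp by blast
  qed (use Z fin S z0 sets in \<open>auto simp: null_sets_def less_top\<close>)
qed

lemma sets_intensity: "sets \<nu> = sets borel \<Longrightarrow> sets (intensity \<nu>) = sets (borel \<Otimes>\<^sub>M borel)"
  unfolding intensity_def by (intro sets_pair_measure_cong) auto

lemma emeasure_intensity_Times:
  assumes "sigma_finite_measure \<nu>" "A \<in> sets borel" "B \<in> sets \<nu>"
  shows "emeasure (intensity \<nu>) (A \<times> B) = emeasure lborel ({0..} \<inter> A) * emeasure \<nu> B"
proof -
  interpret sigma_finite_measure \<nu> by fact
  have "emeasure (density lborel (indicator {0..})) A = emeasure lborel ({0..} \<inter> A)"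
    using assms by (simp add: emeasure_density indicator_inter_arith[symmetric])
  then show ?thesis
    unfolding intensity_def using assms by (subst emeasure_pair_measure_Times) auto
qed

section \<open>Second moments of mild solutions\<close>

lemma finite_jump_mass:
  assumes "levy_measure e \<nu>" "0 < \<eta>"
  shows "emeasure \<nu> (jump_set e \<eta>) < \<infinity>"
proof (rule levy_measure_finite[OF assms(1) jump_set_measurable, of "min 1 (\<eta>\<^sup>2)"])
  show "min 1 (\<eta>\<^sup>2) \<le> min 1 ((hs_norm e z)\<^sup>2)" if "z \<in> jump_set e \<eta>" for z
    using that assms(2) by (intro min.mono power_mono) (auto simp: jump_set_def)
qed (use assms in auto)

text \<open>All exceptional events are gathered into one null set, outside which the hypotheses of
  \<open>jump_path\<close> hold for every time simultaneously.\<close>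

lemma mild_solution_deviation:
  fixes e :: "nat \<Rightarrow> 'h::{real_inner,complete_space,second_countable_topology}"
  assumes M: "prob_space M" and e: "orthonormal_basis e" and lam: "\<And>n. 0 \<le> lam n"
    and eta: "0 < \<eta>" and L: "levy_measure e \<nu>" and D: "AE z in \<nu>. z \<in> diag_HS e"
    and N: "poisson_random_measure M (intensity \<nu>) N"
    and eps: "0 \<le> \<epsilon>" and X: "mild_solution M N e lam \<nu> \<eta> \<epsilon> h X"
  shows "AE \<omega> in M. \<forall>t\<ge>0. norm (X t \<omega> - heat_sg e lam t h) \<le>
    (exp (2 * (\<epsilon> * (measure (N \<omega>) ({0..t} \<times> jump_set e \<eta>) + measure (intensity \<nu>) ({0..t} \<times> jump_set e \<eta>)))) - 1)
      * norm (heat_sg e lam t h)"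
proof -
  interpret nu: sigma_finite_measure \<nu> by (rule levy_measure_sigma_finite[OF e L D])
  note sf = nu.sigma_finite_measure_axioms
  let ?J = "jump_set e \<eta>"
  have nu: "sets \<nu> = sets borel" using L by (simp add: levy_measure_def)
  have spn: "space \<nu> = UNIV" using sets_eq_imp_space_eq[OF nu] by simp
  note sI = sets_intensity[OF nu]
  have J: "?J \<in> sets \<nu>" by (simp add: nu jump_set_measurable)
  have finI: "emeasure (intensity \<nu>) ({0..t} \<times> ?J) < \<infinity>" for t
    using finite_jump_mass[OF L eta]
    by (subst emeasure_intensity_Times[OF sf _ J]) (auto simp: ennreal_mult_less_top emeasure_lborel_Icc_eq)
  from D obtain Z where Z: "Z \<in> null_sets \<nu>" "{z. z \<notin> diag_HS e} \<subseteq> Z"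
    by (auto simp: eventually_ae_filter spn)
  have Z0: "{0} \<times> UNIV \<in> sets (intensity \<nu>)" "UNIV \<times> Z \<in> sets (intensity \<nu>)"
    using Z by (auto simp: sI nu null_sets_def)
  have null: "emeasure (intensity \<nu>) ({0} \<times> UNIV) = 0" "emeasure (intensity \<nu>) (UNIV \<times> Z) = 0"
    using Z sets.top[of \<nu>] by (simp_all add: emeasure_intensity_Times[OF sf] null_sets_def spn)
  have AEs: "AE p in R. fst p \<noteq> 0" "AE p in R. snd p \<in> diag_HS e"
    if R: "sets R = sets (intensity \<nu>)" "emeasure R ({0} \<times> UNIV) = 0" "emeasure R (UNIV \<times> Z) = 0" for R
  proof -
    have n: "{0} \<times> UNIV \<in> null_sets R" "UNIV \<times> Z \<in> null_sets R" using R Z0 by (auto simp: null_sets_def)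
    show "AE p in R. fst p \<noteq> 0" using AE_not_in[OF n(1)] by (auto elim!: eventually_mono)
    show "AE p in R. snd p \<in> diag_HS e" using AE_not_in[OF n(2)] Z(2) by (auto elim!: eventually_mono)
  qed
  \<comment> \<open>Integer horizons keep the number of null events countable; monotonicity extends
    finiteness to every real \<open>t\<close>.\<close>
  have finN: "AE \<omega> in M. \<forall>n. emeasure (N \<omega>) ({0..real n} \<times> ?J) < \<infinity>"
    using J unfolding AE_all_countable
    by (intro allI poisson_finite[OF M N _ finI]) (simp add: sI nu)
  have NS: "sets (N \<omega>) = sets (intensity \<nu>)" if "\<omega> \<in> space M" for \<omega>
    using N that unfolding poisson_random_measure_def by blast
  have XE: "AE \<omega> in M. \<forall>t\<ge>0.
        integrable (N \<omega>) (mild_integrand e lam \<eta> (\<lambda>r. X r \<omega>) t) \<and>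
        integrable (intensity \<nu>) (mild_integrand e lam \<eta> (\<lambda>r. X r \<omega>) t) \<and>
        X t \<omega> = heat_sg e lam t h + \<epsilon> *\<^sub>R
           ((\<integral>p. mild_integrand e lam \<eta> (\<lambda>r. X r \<omega>) t p \<partial>(N \<omega>))
            - (\<integral>p. mild_integrand e lam \<eta> (\<lambda>r. X r \<omega>) t p \<partial>(intensity \<nu>)))"
    using X unfolding mild_solution_def by (rule conjunct2)
  show ?thesis
    using XE finN poisson_null[OF M N Z0(1) null(1)] poisson_null[OF M N Z0(2) null(2)] AE_space
  proof eventually_elim
    case (elim \<omega>)
    have "emeasure (N \<omega>) ({0..t} \<times> ?J) < \<infinity>" for t
    proof -
      obtain n where "t \<le> real n" using real_arch_simple by blast
      then have "emeasure (N \<omega>) ({0..t} \<times> ?J) \<le> emeasure (N \<omega>) ({0..real n} \<times> ?J)"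
        using J by (intro emeasure_mono) (auto simp: NS[OF elim(5)] sI nu)
      also have "\<dots> < \<infinity>" using elim by blast
      finally show ?thesis .
    qed
    then interpret jump_path "N \<omega>" "intensity \<nu>" e lam \<eta> \<epsilon> h "\<lambda>t. X t \<omega>"
      using elim finI
      by unfold_locales (auto simp: e lam eps jump_set_measurable NS sI
          intro!: AEs[OF refl null] AEs[OF NS[OF elim(5)]])
    show ?case using path_deviation unfolding F_def A_def by blast
  qed
qed

text \<open>\<delta> is the logarithm of the expectation of \<open>Z\<close>, which combines the
  deterministic compensator part with the Poisson exponential moment. Both bounds rest on this
  single moment.\<close>

lemma W2_bounds:
  fixes e :: "nat \<Rightarrow> 'h::{real_inner,complete_space,second_countable_topology}"
  assumes M: "prob_space M" and e: "orthonormal_basis e" and lam: "\<And>n. 0 \<le> lam n"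
    and eta: "0 < \<eta>" and L: "levy_measure e \<nu>" and D: "AE z in \<nu>. z \<in> diag_HS e"
    and N: "poisson_random_measure M (intensity \<nu>) N"
    and eps: "0 \<le> \<epsilon>" and X: "mild_solution M N e lam \<nu> \<eta> \<epsilon> h X" and t: "0 \<le> t"
  defines "\<delta> \<equiv> t * measure \<nu> (jump_set e \<eta>) * (4 * \<epsilon> + exp (4 * \<epsilon>) - 1)"
    and "s \<equiv> norm (heat_sg e lam t h)"
  shows "(W2_delta0 M (X t))\<^sup>2 \<le> s\<^sup>2 * exp \<delta>" and "s\<^sup>2 * (3 - 2 * exp \<delta>) \<le> (W2_delta0 M (X t))\<^sup>2"
proof -
  interpret prob_space M by fact
  interpret nu: sigma_finite_measure \<nu> by (rule levy_measure_sigma_finite[OF e L D])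
  define B where "B = {0..t} \<times> jump_set e \<eta>"
  define c where "c = measure \<nu> (jump_set e \<eta>)"
  have nu: "sets \<nu> = sets borel" using L by (simp add: levy_measure_def)
  have J: "jump_set e \<eta> \<in> sets \<nu>" by (simp add: nu jump_set_measurable)
  have Bs: "B \<in> sets (intensity \<nu>)" using J by (simp add: B_def sets_intensity[OF nu] nu)
  have "emeasure \<nu> (jump_set e \<eta>) = ennreal c"
    using finite_jump_mass[OF L eta] by (simp add: c_def emeasure_eq_ennreal_measure)
  then have eB: "emeasure (intensity \<nu>) B = ennreal (t * c)"
    unfolding B_def using t
    by (subst emeasure_intensity_Times[OF nu.sigma_finite_measure_axioms _ J])
      (auto simp: ennreal_mult c_def)
  then have mB: "measure (intensity \<nu>) B = t * c" using t by (simp add: measure_def c_def)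
  have finB: "emeasure (intensity \<nu>) B < \<infinity>" by (simp add: eB)
  define Y where "Y \<omega> = exp (2 * (\<epsilon> * (measure (N \<omega>) B + t * c)))" for \<omega>
  define Z where "Z \<omega> = exp (4 * \<epsilon> * (t * c)) * exp (4 * \<epsilon> * measure (N \<omega>) B)" for \<omega>
  have YZ: "(Y \<omega>)\<^sup>2 = Z \<omega>" for \<omega>
    unfolding Y_def Z_def exp_double[symmetric] exp_add[symmetric] by (simp add: algebra_simps)
  have Y1: "1 \<le> Y \<omega>" for \<omega> unfolding Y_def using eps t by (simp add: c_def)
  have YZle: "Y \<omega> \<le> Z \<omega>" for \<omega>
    using Y1[of \<omega>] by (simp add: YZ[symmetric] power2_eq_square)
  have dev: "AE \<omega> in M. norm (X t \<omega> - heat_sg e lam t h) \<le> (Y \<omega> - 1) * s"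
    using mild_solution_deviation[OF M e lam eta L D N eps X]
    unfolding Y_def mB[symmetric] B_def s_def by eventually_elim (use t in blast)
  have s0: "0 \<le> s" by (simp add: s_def)
  have up: "AE \<omega> in M. (norm (X t \<omega>))\<^sup>2 \<le> s\<^sup>2 * Z \<omega>"
    using dev
  proof eventually_elim
    case (elim \<omega>)
    have "norm (X t \<omega>) \<le> Y \<omega> * s"
      using elim norm_triangle_sub[of "X t \<omega>" "heat_sg e lam t h"] by (simp add: s_def algebra_simps)
    from power_mono[OF this, of 2] show ?case by (simp add: power_mult_distrib YZ mult.commute)
  qed
  \<comment> \<open>The lower bound is stated without subtraction, so that it can be integrated in
    \<open>ennreal\<close>.\<close>
  have low: "AE \<omega> in M. 3 * s\<^sup>2 \<le> (norm (X t \<omega>))\<^sup>2 + 2 * s\<^sup>2 * Z \<omega>"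
    using dev
  proof eventually_elim
    case (elim \<omega>)
    have 1: "(2 - Y \<omega>) * s \<le> norm (X t \<omega>)"
      using elim norm_triangle_sub[of "heat_sg e lam t h" "X t \<omega>"]
      by (simp add: s_def norm_minus_commute algebra_simps)
    have 2: "s\<^sup>2 * (3 - 2 * Y \<omega>) \<le> (norm (X t \<omega>))\<^sup>2"
    \<comment> \<open>Squaring the triangle inequality is legitimate only for
      \<open>Y \<omega> \<le> 2\<close>; otherwise the left side is negative. Linearising by means
      of the square of \<open>Y \<omega> - 1\<close> leaves a bound that is affine in
      \<open>Y \<omega>\<close>.\<close>
    proof (cases "Y \<omega> \<le> 2")
      case True
      have "0 \<le> (Y \<omega> - 1)\<^sup>2" by simp
      then have "3 - 2 * Y \<omega> \<le> (2 - Y \<omega>)\<^sup>2" by (simp add: power2_eq_square algebra_simps)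
      then have "s\<^sup>2 * (3 - 2 * Y \<omega>) \<le> s\<^sup>2 * (2 - Y \<omega>)\<^sup>2" by (rule mult_left_mono) simp
      also have "\<dots> = ((2 - Y \<omega>) * s)\<^sup>2" by (simp add: power_mult_distrib)
      also have "\<dots> \<le> (norm (X t \<omega>))\<^sup>2" using 1 True s0 by (intro power_mono) auto
      finally show ?thesis .
    next
      case False
      then have "s\<^sup>2 * (3 - 2 * Y \<omega>) \<le> 0" by (intro mult_nonneg_nonpos) auto
      then show ?thesis by (rule order_trans) simp
    qed
    have "s\<^sup>2 * Y \<omega> \<le> s\<^sup>2 * Z \<omega>" using YZle by (intro mult_left_mono) auto
    with 2 show ?case by (simp add: algebra_simps)
  qed
  have mNB: "(\<lambda>\<omega>. emeasure (N \<omega>) B) \<in> borel_measurable M"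
    using N Bs unfolding poisson_random_measure_def by blast
  have [measurable]: "Z \<in> borel_measurable M"
    unfolding Z_def measure_def using mNB by measurable
  have [measurable]: "X t \<in> borel_measurable M"
    using X unfolding mild_solution_def by blast
  have "(\<integral>\<^sup>+ \<omega>. ennreal (Z \<omega>) \<partial>M) = ennreal (exp (4 * \<epsilon> * (t * c))) * (\<integral>\<^sup>+ \<omega>. ennreal (exp (4 * \<epsilon> * measure (N \<omega>) B)) \<partial>M)"
    unfolding Z_def using mNB by (simp add: ennreal_mult nn_integral_cmult measure_def)
  also have "\<dots> = ennreal (exp (4 * \<epsilon> * (t * c)) * exp (t * c * (exp (4 * \<epsilon>) - 1)))"
    by (simp add: poisson_exp_moment[OF M N Bs finB] mB ennreal_mult)
  also have "exp (4 * \<epsilon> * (t * c)) * exp (t * c * (exp (4 * \<epsilon>) - 1)) = exp \<delta>"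
    unfolding exp_add[symmetric] \<delta>_def c_def by (simp add: algebra_simps)
  finally have EZ: "(\<integral>\<^sup>+ \<omega>. ennreal (Z \<omega>) \<partial>M) = ennreal (exp \<delta>)" .
  have Z0: "0 \<le> Z \<omega>" for \<omega> by (simp add: Z_def)
  define m where "m = (\<integral>\<^sup>+ \<omega>. ennreal ((norm (X t \<omega>))\<^sup>2) \<partial>M)"
  have "m \<le> (\<integral>\<^sup>+ \<omega>. ennreal (s\<^sup>2) * ennreal (Z \<omega>) \<partial>M)"
    unfolding m_def using up
    by (intro nn_integral_mono_AE) (auto simp: ennreal_mult[symmetric] Z0 elim!: eventually_mono intro: ennreal_leI)
  also have "\<dots> = ennreal (s\<^sup>2 * exp \<delta>)" by (simp add: nn_integral_cmult EZ ennreal_mult)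
  finally have m_up: "m \<le> ennreal (s\<^sup>2 * exp \<delta>)" .
  then have "m < \<infinity>" by (simp add: le_less_trans)
  then have m: "m = ennreal (enn2real m)" by (simp add: less_top)
  have W: "(W2_delta0 M (X t))\<^sup>2 = enn2real m"
    by (simp add: W2_delta0_def m_def)
  show "(W2_delta0 M (X t))\<^sup>2 \<le> s\<^sup>2 * exp \<delta>"
    unfolding W by (rule enn2real_leI[OF _ m_up]) simp
  have "ennreal (3 * s\<^sup>2) = (\<integral>\<^sup>+ \<omega>. ennreal (3 * s\<^sup>2) \<partial>M)" by (simp add: emeasure_space_1)
  also have "\<dots> \<le> (\<integral>\<^sup>+ \<omega>. ennreal ((norm (X t \<omega>))\<^sup>2) + ennreal (2 * s\<^sup>2) * ennreal (Z \<omega>) \<partial>M)"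
    using low
    by (intro nn_integral_mono_AE)
      (auto simp: ennreal_mult[symmetric] ennreal_plus[symmetric] Z0 simp del: ennreal_plus elim!: eventually_mono intro: ennreal_leI)
  also have "\<dots> = m + ennreal (2 * s\<^sup>2) * ennreal (exp \<delta>)"
    by (subst nn_integral_add) (simp_all add: nn_integral_cmult EZ m_def)
  also have "\<dots> = ennreal (enn2real m + 2 * s\<^sup>2 * exp \<delta>)"
    by (subst m) (simp add: ennreal_mult ennreal_plus)
  finally have "3 * s\<^sup>2 \<le> enn2real m + 2 * s\<^sup>2 * exp \<delta>"
    by (subst (asm) ennreal_le_iff) (auto intro: add_nonneg_nonneg)
  then show "s\<^sup>2 * (3 - 2 * exp \<delta>) \<le> (W2_delta0 M (X t))\<^sup>2"
    unfolding W by (simp add: algebra_simps)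
qed

section \<open>Asymptotics\<close>

text \<open>After rescaling by the slowest active rate, the modes in \<open>M_set e lam h\<close>
  are constant in time, lower modes are absent, and the remaining active ones decay. Tannery's
  theorem interchanges limit and sum, with the squared coordinates of \<open>h\<close> as
  majorant.\<close>

lemma heat_sg_asymptotics:
  fixes e :: "nat \<Rightarrow> 'h::{real_inner,complete_space,second_countable_topology}"
  assumes e: "orthonormal_basis e" and lam: "\<And>n. 0 \<le> lam n" and mono: "mono lam"
    and top: "filterlim lam at_top sequentially" and h: "h \<noteq> 0"
  shows "((\<lambda>t. norm (heat_sg e lam t h) * exp (lam (N_idx e h) * t)) \<longlongrightarrow> norm (v_vec e lam h)) at_top"
proof -
  define K where "K = N_idx e h"
  define M where "M = M_set e lam h"
  have below: "e k \<bullet> h = 0" if "k < K" for k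
    using that not_less_Least[of k "\<lambda>k. e k \<bullet> h \<noteq> 0"] by (auto simp: K_def N_idx_def)
  \<comment> \<open>Divergence of the eigenvalues makes the leading eigenspace finite-dimensional,
    so that \<open>v_vec\<close> is a genuine finite sum.\<close>
  have "eventually (\<lambda>n. lam K < lam n) sequentially"
    using top by (simp add: filterlim_at_top_dense)
  then have "finite {n. \<not> lam K < lam n}" by (simp add: eventually_cofinite[symmetric] cofinite_eq_sequentially)
  then have finM: "finite M"
    by (rule rev_finite_subset) (auto simp: M_def M_set_def K_def)
  have "((\<lambda>t. \<Sum>k. (exp (- t * (lam k - lam K)) * (e k \<bullet> h))\<^sup>2) \<longlongrightarrow>
      (\<Sum>k. if k \<in> M then (e k \<bullet> h)\<^sup>2 else 0)) at_top"
  proof (rule tannerys_theorem[THEN conjunct2, THEN conjunct2])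
    fix k
    show "((\<lambda>t. (exp (- t * (lam k - lam K)) * (e k \<bullet> h))\<^sup>2) \<longlongrightarrow> (if k \<in> M then (e k \<bullet> h)\<^sup>2 else 0)) at_top"
    proof (cases "k \<in> M \<or> e k \<bullet> h = 0")
      case True
      then show ?thesis by (auto simp: M_def M_set_def K_def)
    next
      case False
      then have "K \<le> k" using below by (meson not_le)
      then have "lam K < lam k"
        using False monoD[OF mono, of K k] by (auto simp: M_def M_set_def K_def)
      then have "filterlim (\<lambda>t. (lam k - lam K) * t) at_top at_top"
        by (intro filterlim_tendsto_pos_mult_at_top[OF tendsto_const _ filterlim_ident]) auto
      then have "((\<lambda>t. exp (- ((lam k - lam K) * t))) \<longlongrightarrow> 0) at_top"
        by (intro filterlim_compose[OF exp_at_bot] filterlim_uminus_at_bot[THEN iffD2]) simp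
      then have "((\<lambda>t. (exp (- ((lam k - lam K) * t)) * (e k \<bullet> h))\<^sup>2) \<longlongrightarrow> (0 * (e k \<bullet> h))\<^sup>2) at_top"
        by (intro tendsto_intros)
      then show ?thesis using False by (simp add: mult.commute)
    qed
  next
    have b: "norm ((exp (- t * (lam k - lam K)) * (e k \<bullet> h))\<^sup>2) \<le> (e k \<bullet> h)\<^sup>2" if t: "0 \<le> t" for k t
    proof (cases "k < K")
      case False
      then have "0 \<le> t * (lam k - lam K)" using t monoD[OF mono, of K k] by simp
      then have "(exp (- (t * (lam k - lam K))))\<^sup>2 \<le> 1" by (intro power_le_one) auto
      then have "(exp (- (t * (lam k - lam K))))\<^sup>2 * (e k \<bullet> h)\<^sup>2 \<le> 1 * (e k \<bullet> h)\<^sup>2"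
        by (intro mult_right_mono) auto
      then show ?thesis by (simp add: power_mult_distrib)
    qed (simp add: below)
    show "\<forall>\<^sub>F (k, t) in sequentially \<times>\<^sub>F at_top. norm ((exp (- t * (lam k - lam K)) * (e k \<bullet> h))\<^sup>2) \<le> (e k \<bullet> h)\<^sup>2"
      unfolding eventually_prod_filter
      by (rule exI[of _ "\<lambda>_. True"], rule exI[of _ "\<lambda>t. 0 \<le> t"])
        (use b in \<open>auto simp: eventually_ge_at_top\<close>)
  qed (use summable_coord_sq[OF e] in auto)
  also have "(\<Sum>k. if k \<in> M then (e k \<bullet> h)\<^sup>2 else 0) = (norm (v_vec e lam h))\<^sup>2"
    using norm_sum_orthonormal[OF e finM, of "\<lambda>k. e k \<bullet> h"] finM
    by (subst suminf_finite[OF finM]) (auto simp: v_vec_def M_def)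
  finally have "((\<lambda>t. \<Sum>k. (exp (- t * (lam k - lam K)) * (e k \<bullet> h))\<^sup>2) \<longlongrightarrow> (norm (v_vec e lam h))\<^sup>2) at_top" .
  from tendsto_real_sqrt[OF this]
  have "((\<lambda>t. sqrt (\<Sum>k. (exp (- t * (lam k - lam K)) * (e k \<bullet> h))\<^sup>2)) \<longlongrightarrow> norm (v_vec e lam h)) at_top"
    by simp
  moreover have "\<forall>\<^sub>F t in at_top. sqrt (\<Sum>k. (exp (- t * (lam k - lam K)) * (e k \<bullet> h))\<^sup>2) =
      norm (heat_sg e lam t h) * exp (lam K * t)"
    using eventually_ge_at_top[of 0]
  proof eventually_elim
    case (elim t)
    have "(\<Sum>k. (exp (- t * (lam k - lam K)) * (e k \<bullet> h))\<^sup>2) =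
        (\<Sum>k. (exp (lam K * t))\<^sup>2 * (e k \<bullet> heat_sg e lam t h)\<^sup>2)"
    proof (intro arg_cong[where f=suminf] ext)
      fix k
      have "exp (- t * (lam k - lam K)) = exp (lam K * t) * exp (- t * lam k)"
        unfolding exp_add[symmetric] by (simp add: algebra_simps)
      then show "(exp (- t * (lam k - lam K)) * (e k \<bullet> h))\<^sup>2 = (exp (lam K * t))\<^sup>2 * (e k \<bullet> heat_sg e lam t h)\<^sup>2"
        by (simp only: inner_heat_sg[OF e lam elim] power_mult_distrib mult.assoc)
    qed
    also have "\<dots> = (norm (heat_sg e lam t h) * exp (lam K * t))\<^sup>2"
      by (simp add: suminf_mult summable_coord_sq[OF e] parseval[OF e] power_mult_distrib)
    finally show ?case by (simp add: real_sqrt_unique)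
  qed
  ultimately show ?thesis unfolding K_def by (rule Lim_transform_eventually)
qed

theorem mainTheorem19:
  fixes M :: "'w measure"
    and e :: "nat \<Rightarrow> 'h::{real_inner,complete_space,second_countable_topology}"
    and lam :: "nat \<Rightarrow> real"
    and DA :: "'h set" and A :: "'h \<Rightarrow> 'h"
    and \<nu> :: "('h \<Rightarrow>\<^sub>L 'h) measure"
    and N :: "'w \<Rightarrow> (real \<times> ('h \<Rightarrow>\<^sub>L 'h)) measure"
    and \<eta> :: real and h :: 'h
    and X :: "real \<Rightarrow> real \<Rightarrow> 'w \<Rightarrow> 'h"
    and a :: "real \<Rightarrow> real" and \<rho> :: real
  assumes "prob_space M"
    and "heat_hyp e lam DA A"
    and "0 < \<eta>" and "\<eta> < 1"
    and "levy_measure e \<nu>"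
    and "AE z in \<nu>. z \<in> diag_HS e"
    and "poisson_random_measure M (intensity \<nu>) N"
    and "h \<in> DA" and "h \<noteq> 0"
    and "\<forall>\<epsilon>\<in>{0<..<1}. mild_solution M N e lam \<nu> \<eta> \<epsilon> h (X \<epsilon>)"
    and "\<forall>\<epsilon>\<in>{0<..<1}. 0 < a \<epsilon>"
    and "(a \<longlongrightarrow> 0) (at_right 0)"
    and "((\<lambda>\<epsilon>. \<epsilon> * \<bar>ln (a \<epsilon>)\<bar>) \<longlongrightarrow> 0) (at_right 0)"
  shows "((\<lambda>\<epsilon>. W2_delta0 M (X \<epsilon> (\<bar>ln (a \<epsilon>)\<bar> / lam (N_idx e h) + \<rho>)) / a \<epsilon>)
           \<longlongrightarrow> exp (- lam (N_idx e h) * \<rho>) * norm (v_vec e lam h)) (at_right 0)"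
proof -
  have e: "orthonormal_basis e" and lam0: "0 < lam 0" and mono: "mono lam"
    and top: "filterlim lam at_top sequentially"
    using assms(2) by (auto simp: heat_hyp_def)
  have lampos: "0 < lam n" for n
    using lam0 monoD[OF mono, of 0 n] by simp
  then have lam: "0 \<le> lam n" for n by (simp add: less_imp_le)
  define l where "l = lam (N_idx e h)"
  have l: "0 < l" unfolding l_def by (rule lampos)
  define c where "c = measure \<nu> (jump_set e \<eta>)"
  define t where "t \<epsilon> = \<bar>ln (a \<epsilon>)\<bar> / l + \<rho>" for \<epsilon>
  define s where "s \<epsilon> = norm (heat_sg e lam (t \<epsilon>) h)" for \<epsilon>
  define \<delta> where "\<delta> \<epsilon> = t \<epsilon> * c * (4 * \<epsilon> + exp (4 * \<epsilon>) - 1)" for \<epsilon>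
  define W where "W \<epsilon> = W2_delta0 M (X \<epsilon> (t \<epsilon>))" for \<epsilon>
  define L where "L = exp (- l * \<rho>) * norm (v_vec e lam h)"
  have ev01: "\<forall>\<^sub>F \<epsilon> in at_right 0. \<epsilon> \<in> {0<..<1::real}"
    by (rule eventually_at_right_real) simp
  have apos: "\<forall>\<^sub>F \<epsilon> in at_right 0. 0 < a \<epsilon>"
    using ev01 by eventually_elim (use assms(11) in blast)
  have a1: "\<forall>\<^sub>F \<epsilon> in at_right 0. a \<epsilon> < 1"
    by (rule order_tendstoD(2)[OF assms(12)]) simp
  \<comment> \<open>Positivity of \<open>a\<close> makes the approach to 0 one-sided, which the
    limit of the logarithm requires.\<close>
  have "filterlim a (at_right 0) (at_right 0)"
    using assms(12) apos by (simp add: filterlim_at eventually_conj_iff)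
      (auto elim!: eventually_mono)
  then have "filterlim (\<lambda>\<epsilon>. ln (a \<epsilon>)) at_bot (at_right 0)"
    by (rule filterlim_compose[OF ln_at_0])
  then have lntop: "filterlim (\<lambda>\<epsilon>. \<bar>ln (a \<epsilon>)\<bar>) at_top (at_right 0)"
    by (rule filterlim_at_infinity_imp_norm_at_top[OF filterlim_at_bot_imp_at_infinity, unfolded real_norm_def])
  have ttop: "filterlim t at_top (at_right 0)"
  proof -
    have "filterlim (\<lambda>\<epsilon>. inverse l * \<bar>ln (a \<epsilon>)\<bar>) at_top (at_right 0)"
      using l by (intro filterlim_tendsto_pos_mult_at_top[OF tendsto_const _ lntop]) auto
    then have "filterlim (\<lambda>\<epsilon>. \<rho> + inverse l * \<bar>ln (a \<epsilon>)\<bar>) at_top (at_right 0)"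
      by (rule filterlim_tendsto_add_at_top[OF tendsto_const])
    then show ?thesis by (simp add: t_def[abs_def] field_simps)
  qed
  have et: "((\<lambda>\<epsilon>. \<epsilon> * t \<epsilon>) \<longlongrightarrow> 0) (at_right 0)"
  proof -
    have "((\<lambda>\<epsilon>. \<epsilon> * \<bar>ln (a \<epsilon>)\<bar> / l + \<epsilon> * \<rho>) \<longlongrightarrow> 0 / l + 0 * \<rho>) (at_right 0)"
      using l by (intro tendsto_intros assms(13)) auto
    then show ?thesis by (simp add: t_def distrib_left)
  qed
  \<comment> \<open>This derivative shows that \<delta> is the product of
    \<open>\<epsilon> * t \<epsilon>\<close>, which tends to 0, and a factor with a finite
    limit.\<close>
  have "DERIV (\<lambda>x. exp (4 * x)) 0 :> (4::real)"
    by (auto intro!: derivative_eq_intros)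
  from DERIV_D[OF this] have "((\<lambda>\<epsilon>. (exp (4 * \<epsilon>) - 1) / \<epsilon>) \<longlongrightarrow> (4::real)) (at 0)"
    by simp
  then have q: "((\<lambda>\<epsilon>. (exp (4 * \<epsilon>) - 1) / \<epsilon>) \<longlongrightarrow> (4::real)) (at_right 0)"
    by (rule tendsto_within_subset) simp
  have d: "(\<delta> \<longlongrightarrow> 0) (at_right 0)"
  proof (rule Lim_transform_eventually)
    have "((\<lambda>\<epsilon>. (\<epsilon> * t \<epsilon>) * c * (4 + (exp (4 * \<epsilon>) - 1) / \<epsilon>)) \<longlongrightarrow> 0 * c * (4 + 4)) (at_right 0)"
      by (intro tendsto_intros et q)
    then show "((\<lambda>\<epsilon>. (\<epsilon> * t \<epsilon>) * c * (4 + (exp (4 * \<epsilon>) - 1) / \<epsilon>)) \<longlongrightarrow> 0) (at_right 0)" by simp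
    show "\<forall>\<^sub>F \<epsilon> in at_right 0. (\<epsilon> * t \<epsilon>) * c * (4 + (exp (4 * \<epsilon>) - 1) / \<epsilon>) = \<delta> \<epsilon>"
      using ev01 by eventually_elim (simp add: \<delta>_def field_simps)
  qed
  have sa: "((\<lambda>\<epsilon>. s \<epsilon> / a \<epsilon>) \<longlongrightarrow> L) (at_right 0)"
  proof (rule Lim_transform_eventually)
    show "((\<lambda>\<epsilon>. exp (- l * \<rho>) * (s \<epsilon> * exp (l * t \<epsilon>))) \<longlongrightarrow> L) (at_right 0)"
      unfolding L_def s_def l_def
      by (intro tendsto_intros filterlim_compose[OF heat_sg_asymptotics[OF e lam mono top assms(9)] ttop])
    \<comment> \<open>Once \<open>a \<epsilon> < 1\<close>, the absolute value of the logarithm is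
      its negative, and \<open>exp (l * t \<epsilon>)\<close> equals
      \<open>exp (l * \<rho>) / a \<epsilon>\<close>: the time scale is chosen for exactly
      this.\<close>
    show "\<forall>\<^sub>F \<epsilon> in at_right 0. exp (- l * \<rho>) * (s \<epsilon> * exp (l * t \<epsilon>)) = s \<epsilon> / a \<epsilon>"
      using apos a1
    proof eventually_elim
      case (elim \<epsilon>)
      then have "l * t \<epsilon> = - ln (a \<epsilon>) + l * \<rho>" using l by (simp add: t_def distrib_left right_diff_distrib ln_less_zero)
      then have "exp (- l * \<rho>) * exp (l * t \<epsilon>) = inverse (a \<epsilon>)"
        using elim unfolding exp_add[symmetric] by (simp add: exp_minus)
      then show ?case by (simp add: divide_inverse mult.left_commute)
    qed
  qed
  have bounds: "\<forall>\<^sub>F \<epsilon> in at_right 0. (s \<epsilon> / a \<epsilon>)\<^sup>2 * (3 - 2 * exp (\<delta> \<epsilon>)) \<le> (W \<epsilon> / a \<epsilon>)\<^sup>2 \<and>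
      (W \<epsilon> / a \<epsilon>)\<^sup>2 \<le> (s \<epsilon> / a \<epsilon>)\<^sup>2 * exp (\<delta> \<epsilon>)"
    \<comment> \<open>The shift \<rho> may be negative, so nonnegativity of
      \<open>t \<epsilon>\<close> holds only eventually.\<close>
    using ev01 apos filterlim_at_top_dense[THEN iffD1, OF ttop, rule_format, of 0]
  proof eventually_elim
    case (elim \<epsilon>)
    have ms: "mild_solution M N e lam \<nu> \<eta> \<epsilon> h (X \<epsilon>)" using assms(10) elim(1) by blast
    have "0 \<le> \<epsilon>" "0 \<le> t \<epsilon>" using elim by auto
    note W2 = W2_bounds[OF assms(1) e lam assms(3,5,6,7) this(1) ms this(2)]
    then have "(W \<epsilon>)\<^sup>2 \<le> (s \<epsilon>)\<^sup>2 * exp (\<delta> \<epsilon>)" "(s \<epsilon>)\<^sup>2 * (3 - 2 * exp (\<delta> \<epsilon>)) \<le> (W \<epsilon>)\<^sup>2"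
      by (simp_all only: W_def s_def \<delta>_def c_def)
    from this[THEN divide_right_mono, of "(a \<epsilon>)\<^sup>2"] show ?case
      by (simp add: power_divide)
  qed
  \<comment> \<open>As \<delta> tends to 0, both outer factors,
    \<open>3 - 2 * exp (\<delta> \<epsilon>)\<close> and \<open>exp (\<delta> \<epsilon>)\<close>,
    tend to 1. Working with squares avoids a root of the lower factor, which may be negative at
    first.\<close>
  have "((\<lambda>\<epsilon>. (W \<epsilon> / a \<epsilon>)\<^sup>2) \<longlongrightarrow> L\<^sup>2) (at_right 0)"
  proof (rule tendsto_sandwich)
    have "((\<lambda>\<epsilon>. (s \<epsilon> / a \<epsilon>)\<^sup>2 * (3 - 2 * exp (\<delta> \<epsilon>))) \<longlongrightarrow> L\<^sup>2 * (3 - 2 * exp 0)) (at_right 0)"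
      by (intro tendsto_intros sa d)
    then show "((\<lambda>\<epsilon>. (s \<epsilon> / a \<epsilon>)\<^sup>2 * (3 - 2 * exp (\<delta> \<epsilon>))) \<longlongrightarrow> L\<^sup>2) (at_right 0)" by simp
    have "((\<lambda>\<epsilon>. (s \<epsilon> / a \<epsilon>)\<^sup>2 * exp (\<delta> \<epsilon>)) \<longlongrightarrow> L\<^sup>2 * exp 0) (at_right 0)"
      by (intro tendsto_intros sa d)
    then show "((\<lambda>\<epsilon>. (s \<epsilon> / a \<epsilon>)\<^sup>2 * exp (\<delta> \<epsilon>)) \<longlongrightarrow> L\<^sup>2) (at_right 0)" by simp
  qed (use bounds in \<open>auto elim: eventually_mono\<close>)
  then have "((\<lambda>\<epsilon>. sqrt ((W \<epsilon> / a \<epsilon>)\<^sup>2)) \<longlongrightarrow> sqrt (L\<^sup>2)) (at_right 0)"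
    by (rule tendsto_real_sqrt)
  moreover have "\<forall>\<^sub>F \<epsilon> in at_right 0. sqrt ((W \<epsilon> / a \<epsilon>)\<^sup>2) = W \<epsilon> / a \<epsilon>"
    using apos by eventually_elim (simp add: W_def W2_delta0_def)
  ultimately have "((\<lambda>\<epsilon>. W \<epsilon> / a \<epsilon>) \<longlongrightarrow> sqrt (L\<^sup>2)) (at_right 0)"
    by (rule Lim_transform_eventually)
  then show ?thesis by (simp add: W_def t_def l_def L_def)
qed

end
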